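(* Assume the setting of truncated distributions, test functions and Stein estimators described in the context, with $X_1,X_2,\ldots$ i.i.d. with law ${}_{a^\star}^{b^\star}\mathbb{P}_{\theta^\star}$, and let $X\sim{}_{a^\star}^{b^\star}\mathbb{P}_{\theta^\star}$. Suppose that: (a) $f_{a^\star}^{b^\star}\in{}_{a^\star}^{b^\star}\mathscr{F}$ (componentwise), and for $\theta\in\Theta$ one has $\mathbb{E}[\mathcal{A}_\theta f_{a^\star}^{b^\star}(X)]=0$ if and only if $\theta=\theta^\star$; moreover $\mathbb{E}[\Vert M_{a'}^{b'}(X)\Vert^2]<\infty$ for all $a^\star\le a'\le b'\le b^\star$, with $M_{a'}^{b'}$ as in (b). (b) There are $\tilde q\ge q$, measurable $q\times\tilde q$-matrix-valued functions $M_a^b$ and a continuously differentiable function $g=(g_1,\ldots,g_{\tilde q})^\top:\Theta\to\mathbb{R}^{\tilde q}$ such that $\mathcal{A}_\theta f_a^b(k)=M_a^b(k)g(\theta)$ for all $\theta\in\Theta$ and $k\in\{a,\ldots,b\}$; and the $q\times q$ matrix $\mathbb{E}[M_{a^\star}^{b^\star}(X)]\,\frac{\partial}{\partial\theta}g(\theta)\big|_{\theta=\theta^\star}$ is invertible. (c) There is $C>0$ such that $$\bigg\Vert\frac{\partial^2}{\partial\theta_j\partial\theta_l}\mathcal{A}_\theta f_{a'}^{b'}(k)\Big|_{\theta=\theta'}\bigg\Vert\le C$$ for all $\theta'\in\Theta$, $a^\star\le k\le b^\star$, $a^\star\le a'\le b'\le b^\star$ and $1\le j,l\le q$. Let $(\hat\theta_n)$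 be the (consistent) sequence of Stein estimators computed with the estimated truncation points $\hat a_n,\hat b_n$. Then, as $n\to\infty$, $$\sqrt n(\hat\theta_n-\theta^\star)\xrightarrow{D}N(0,\Sigma),$$ where $$\Sigma=\mathbb{E}\bigg[\frac{\partial}{\partial\theta}\mathcal{A}_\theta f_{a^\star}^{b^\star}(X)\Big|_{\theta=\theta^\star}\bigg]^{-1}\mathbb{E}\Big[\mathcal{A}_{\theta^\star}f_{a^\star}^{b^\star}(X)\,\big(\mathcal{A}_{\theta^\star}f_{a^\star}^{b^\star}(X)\big)^\top\Big]\,\mathbb{E}\bigg[\frac{\partial}{\partial\theta}\mathcal{A}_\theta f_{a^\star}^{b^\star}(X)\Big|_{\theta=\theta^\star}\bigg]^{-\top}.$$
   Context: Truncated family: $\Theta\subset\mathbb{R}^q$ is open, $I\subset\mathbb{Z}$ is a set of consecutive integers, and for each $\theta\in\Theta$, $p_\theta:I\to(0,\infty)$ and $\tau_\theta:I\to\mathbb{R}$ are given functions. For finite integers $a<b$ with $\{a,\ldots,b\}\subset I$, ${}_a^b\mathbb{P}_\theta$ is the distribution on $\{a,\ldots,b\}$ with probability mass function proportional to $p_\theta(k)$, $k\in\{a,\ldots,b\}$. The true parameters are $\theta^\star\in\Theta$ and $-\infty<a^\star<b^\star<\infty$ with $\{a^\star,\ldots,b^\star\}\subset I$; the i.i.d. sample is defined on a common probability space $(\Omega,\mathcal{F},\mathbb{P})$. Stein operator (it does not depend on the truncation points or the normalizing constant): $$\mathcal{A}_\theta f(k)=\frac{f(k+1)p_\theta(k+1)\tau_\theta(k+1)}{p_\theta(k)}-f(k)\tau_\theta(k),$$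 where a test function $f$ associated with the truncation domain $\{a,\ldots,b\}$ is set to $0$ outside $\{a,\ldots,b\}$, and the first term is $0$ whenever $f(k+1)=0$ (the values of $p_\theta,\tau_\theta$ at $k+1\notin I$ being taken as arbitrary positive numbers). For vector-valued $f=(f_1,\ldots,f_q)^\top$, $\mathcal{A}_\theta f=(\mathcal{A}_\theta f_1,\ldots,\mathcal{A}_\theta f_q)^\top$. Test functions: ${}_a^b\mathscr{F}$ is the class of functions $f:\{a,\ldots,b+1\}\to\mathbb{R}$ with $f(a)=0$ and $f(b+1)=0$. For each $a^\star\le a\le b\le b^\star$ one fixes test functions $(f_a^b)_1,\ldots,(f_a^b)_q\in{}_a^b\mathscr{F}$, and writes $f_a^b=((f_a^b)_1,\ldots,(f_a^b)_q)^\top$. Condition (b) is required for all these $(a,b)$, the functions $M_a^b$ being defined on $\mathbb{Z}$. Estimators: $\hat a_n=\min\{X_1,\ldots,X_n\}$, $\hat b_n=\max\{X_1,\ldots,X_n\}$, and the Stein estimator $\hat\theta_n\in\Theta$ is a solution in $\theta$ of the $q$ equations $$\frac1n\sum_{i=1}^n\mathcal{A}_\theta(f_{\hat a_n}^{\hat b_n})_j(X_i)=0,\qquad j=1,\ldots,q.$$ The sequence $(\hat\theta_n)$ is a sequence of random vectors with values in $\Theta$ which solve this system with probability converging to $1$ and which is consistent, i.e. $\hat\theta_n\to\theta^\star$ in probability. $\frac{\partial}{\partial\theta}$ denotes the Jacobian with respect to $\theta$; $A^{-\top}=(A^{-1})^\top$; $\xrightarrow{D}$ is convergence in distribution. *)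

theory Defs
  imports "HOL-Probability.Probability"
begin

subsection \<open>Truncated distributions\<close>

definition truncated_pmf :: "(int \<Rightarrow> real) \<Rightarrow> int \<Rightarrow> int \<Rightarrow> int pmf" where
  "truncated_pmf p a b =
     embed_pmf (\<lambda>k. if k \<in> {a..b} then p k / (\<Sum>i = a..b. p i) else 0)"

text \<open>The argument of \<^const>\<open>embed_pmf\<close> is a probability mass function whenever \<open>p\<close> is
  positive on a nonempty \<open>{a..b}\<close>; no other case is used.\<close>

lemma pmf_truncated_pmf:
  assumes "a \<le> b" and "\<And>k. k \<in> {a..b} \<Longrightarrow> p k > 0"
  shows "pmf (truncated_pmf p a b) k = (if k \<in> {a..b} then p k / (\<Sum>i = a..b. p i) else 0)"
proof -
  let ?f = "\<lambda>k. if k \<in> {a..b} then p k / (\<Sum>i = a..b. p i) else 0"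
  have S: "(\<Sum>i = a..b. p i) > 0"
    using assms by (intro sum_pos) auto
  have nn: "?f k \<ge> 0" for k
    using S assms(2)[of k] by (auto intro!: divide_nonneg_pos less_imp_le)
  have "(\<integral>\<^sup>+k. ennreal (?f k) \<partial>count_space UNIV) = (\<Sum>k \<in> {a..b}. ennreal (?f k))"
    by (rule nn_integral_count_space') auto
  also have "\<dots> = ennreal (\<Sum>k \<in> {a..b}. ?f k)"
    using nn by (intro sum_ennreal)
  also have "(\<Sum>k \<in> {a..b}. ?f k) = 1"
    using S by (simp add: sum_divide_distrib[symmetric])
  finally have "(\<integral>\<^sup>+k. ennreal (?f k) \<partial>count_space UNIV) = 1"
    by simp
  with nn show ?thesis
    unfolding truncated_pmf_def by (intro pmf_embed_pmf)
qed

subsection \<open>Test functions and the Stein operator\<close>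

text \<open>Test functions on \<open>{a..b+1}\<close> are represented by their extension by zero to all integers.\<close>

definition test_class :: "int \<Rightarrow> int \<Rightarrow> (int \<Rightarrow> real) set" where
  "test_class a b = {f. f a = 0 \<and> f (b + 1) = 0 \<and> (\<forall>k. k \<notin> {a..b} \<longrightarrow> f k = 0)}"

text \<open>The first term vanishes whenever \<open>f (k + 1) = 0\<close>. For \<open>f\<close> in \<open>test_class a b\<close>, the values
  of \<open>p\<close> and \<open>\<tau>\<close> outside \<open>{a..b}\<close> therefore never contribute.\<close>

definition stein_op :: "(int \<Rightarrow> real) \<Rightarrow> (int \<Rightarrow> real) \<Rightarrow> (int \<Rightarrow> real) \<Rightarrow> int \<Rightarrow> real" where
  "stein_op p \<tau> f k = f (k + 1) * p (k + 1) * \<tau> (k + 1) / p k - f k * \<tau> k"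

definition stein_op_vec ::
    "(int \<Rightarrow> real) \<Rightarrow> (int \<Rightarrow> real) \<Rightarrow> (int \<Rightarrow> real ^ 'q) \<Rightarrow> int \<Rightarrow> real ^ 'q" where
  "stein_op_vec p \<tau> F k = (\<chi> j. stein_op p \<tau> (\<lambda>i. F i $ j) k)"

subsection \<open>Partial derivatives and continuous differentiability\<close>

definition partially_differentiable ::
    "'q \<Rightarrow> (real ^ 'q \<Rightarrow> 'b::real_normed_vector) \<Rightarrow> real ^ 'q \<Rightarrow> bool" where
  "partially_differentiable j F x \<longleftrightarrow> (\<lambda>t. F (x + t *\<^sub>R axis j (1::real))) differentiable (at 0)"

definition partial_deriv ::
    "'q \<Rightarrow> (real ^ 'q \<Rightarrow> 'b::real_normed_vector) \<Rightarrow> real ^ 'q \<Rightarrow> 'b" where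
  "partial_deriv j F x = vector_derivative (\<lambda>t. F (x + t *\<^sub>R axis j (1::real))) (at 0)"

definition continuously_differentiable_on ::
    "(real ^ 'q \<Rightarrow> real ^ 'r) \<Rightarrow> (real ^ 'q) set \<Rightarrow> bool" where
  "continuously_differentiable_on g T \<longleftrightarrow>
     (\<forall>x\<in>T. g differentiable (at x)) \<and> continuous_on T (\<lambda>x. jacobian g (at x))"

subsection \<open>Modes of convergence and the multivariate normal distribution\<close>

definition converges_in_prob ::
    "'w measure \<Rightarrow> (nat \<Rightarrow> 'w \<Rightarrow> 'b::metric_space) \<Rightarrow> 'b \<Rightarrow> bool" where
  "converges_in_prob P Y c \<longleftrightarrow>
     (\<forall>e>0. (\<lambda>n. measure P {w \<in> space P. dist (Y n w) c > e}) \<longlonglongrightarrow> 0)"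

text \<open>Convergence in distribution of random vectors to a probability law \<open>N\<close>; the library's
  notion \<^const>\<open>weak_conv_m\<close> only covers laws on the real line.\<close>

definition converges_in_distribution ::
    "'w measure \<Rightarrow> (nat \<Rightarrow> 'w \<Rightarrow> 'b::metric_space) \<Rightarrow> 'b measure \<Rightarrow> bool" where
  "converges_in_distribution P Y N \<longleftrightarrow>
     (\<forall>n. Y n \<in> borel_measurable P) \<and> prob_space N \<and> sets N = sets borel \<and>
     (\<forall>h :: 'b \<Rightarrow> real. continuous_on UNIV h \<and> bounded (range h) \<longrightarrow>
        (\<lambda>n. \<integral>w. h (Y n w) \<partial>P) \<longlonglongrightarrow> (\<integral>y. h y \<partial>N))"

text \<open>The normal law on the line with mean \<open>m\<close> and variance \<open>v \<ge> 0\<close>, a point mass if \<open>v = 0\<close>.\<close>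

definition normal_law :: "real \<Rightarrow> real \<Rightarrow> real measure" where
  "normal_law m v =
     (if v = 0 then return borel m else density lborel (normal_density m (sqrt v)))"

text \<open>\<open>N\<close> is the (possibly degenerate) law N(m, S): every linear functional is normally
  distributed with the corresponding mean and variance. This determines \<open>N\<close> uniquely
  (Cramer--Wold).\<close>

definition is_multivariate_normal ::
    "(real ^ 'q) measure \<Rightarrow> real ^ 'q \<Rightarrow> real ^ 'q ^ 'q \<Rightarrow> bool" where
  "is_multivariate_normal N m S \<longleftrightarrow>
     prob_space N \<and> sets N = sets borel \<and> transpose S = S \<and>
     (\<forall>t. t \<bullet> (S *v t) \<ge> 0 \<and>
          distr N borel (\<lambda>x. t \<bullet> x) = normal_law (t \<bullet> m) (t \<bullet> (S *v t)))"

definition outer_product :: "real ^ 'q \<Rightarrow> real ^ 'q \<Rightarrow> real ^ 'q ^ 'q" where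
  "outer_product u v = (\<chi> i j. u $ i * v $ j)"

subsection \<open>Estimators\<close>

text \<open>The sample is \<open>X 1, X 2, \<dots>\<close>; \<open>n = 0\<close> is irrelevant for the limits considered.\<close>

definition min_est :: "(nat \<Rightarrow> 'w \<Rightarrow> int) \<Rightarrow> nat \<Rightarrow> 'w \<Rightarrow> int" where
  "min_est X n w = Min ((\<lambda>i. X i w) ` {1..n})"

definition max_est :: "(nat \<Rightarrow> 'w \<Rightarrow> int) \<Rightarrow> nat \<Rightarrow> 'w \<Rightarrow> int" where
  "max_est X n w = Max ((\<lambda>i. X i w) ` {1..n})"

definition solves_stein_eqs ::
    "(real ^ 'q \<Rightarrow> int \<Rightarrow> real) \<Rightarrow> (real ^ 'q \<Rightarrow> int \<Rightarrow> real) \<Rightarrow> (int \<Rightarrow> int \<Rightarrow> int \<Rightarrow> real ^ 'q)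
      \<Rightarrow> (nat \<Rightarrow> 'w \<Rightarrow> int) \<Rightarrow> nat \<Rightarrow> 'w \<Rightarrow> real ^ 'q \<Rightarrow> bool" where
  "solves_stein_eqs p \<tau> f X n w \<theta> \<longleftrightarrow>
     (\<forall>j. (1 / real n) *
          (\<Sum>i = 1..n. stein_op (p \<theta>) (\<tau> \<theta>)
                         (\<lambda>k. f (min_est X n w) (max_est X n w) k $ j) (X i w)) = 0)"

end

theory Submission
  imports Defs
begin

text \<open>Only finitely many values can be sampled, and both true truncation points have positive mass.
  Hence with probability tending to one the sample minimum and maximum are the true truncation
  points, and the Stein equations become those with known truncation: the estimator solves
  \<open>A n *v g \<theta> = 0\<close>, where \<open>A n\<close> is the sample mean of the matrices \<open>M as bs (X i)\<close>.

  The estimator is then a Z-estimator. Expanding \<open>g\<close> at \<open>\<theta>s\<close> with Jacobian \<open>G\<close> and using that \<open>A n\<close>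
  tends to its mean, where \<open>D\<close> is this mean times \<open>G\<close>, the scaled error \<open>sqrt n *\<^sub>R (est n - \<theta>s)\<close>
  differs from \<open>- (D\<^sup>-\<^sup>1 *v (sqrt n *\<^sub>R (A n *v g \<theta>s)))\<close> by a term that vanishes in probability
  (\<open>z_estimator_asymptotically_linear\<close>, resting on \<open>linearization_error\<close>). The latter is a
  normalized sum of independent, centred, finitely supported vectors with covariance \<open>\<Sigma>\<close>, to which
  \<open>central_limit_theorem_vector\<close> applies, and \<open>slutsky\<close> transfers the limit to the estimator.

  The multivariate central limit theorem is reduced to the line by \<open>cramer_wold\<close>. Its heart is
  \<open>trig_poly_approximation\<close>: bounded continuous functions are approximated by trigonometric
  polynomials whose sup norm stays under control, so that limits of expectations of waves, that is,
  of functions of one linear functional, determine the limit. The limiting Gaussian law is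
  constructed explicitly as a linear image of independent standard normal variables
  (\<open>gaussian_law_exists\<close>).\<close>

section \<open>Approximation by trigonometric polynomials\<close>

text \<open>Trigonometric polynomials with arbitrary real frequencies. The phase \<open>s\<close> makes one
  constructor cover both sines and cosines, and constants are waves of frequency \<open>0\<close>.\<close>

inductive trig_poly :: "('a::real_inner \<Rightarrow> real) \<Rightarrow> bool" where
  wave: "trig_poly (\<lambda>x. a * cos (t \<bullet> x + s))"
| add: "trig_poly \<phi> \<Longrightarrow> trig_poly \<psi> \<Longrightarrow> trig_poly (\<lambda>x. \<phi> x + \<psi> x)"

lemma trig_poly_const: "trig_poly (\<lambda>x. c)"
  using wave[of c 0 0] by simp

lemma trig_poly_sum:
  "finite B \<Longrightarrow> (\<And>b. b \<in> B \<Longrightarrow> trig_poly (\<phi> b)) \<Longrightarrow> trig_poly (\<lambda>x. \<Sum>b\<in>B. \<phi> b x)"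
  by (induction B rule: finite_induct) (auto intro: trig_poly_const trig_poly.add)

lemma trig_poly_wave_mult:
  assumes "trig_poly \<phi>"
  shows "trig_poly (\<lambda>x. a * cos (t \<bullet> x + s) * \<phi> x)"
  using assms
proof induction
  case (wave a' t' s')
  have eq: "a * cos (t \<bullet> x + s) * (a' * cos (t' \<bullet> x + s')) =
      (a * a' / 2) * cos ((t - t') \<bullet> x + (s - s')) + (a * a' / 2) * cos ((t + t') \<bullet> x + (s + s'))"
    for x
  proof -
    have "(t - t') \<bullet> x + (s - s') = (t \<bullet> x + s) - (t' \<bullet> x + s')"
      and "(t + t') \<bullet> x + (s + s') = (t \<bullet> x + s) + (t' \<bullet> x + s')"
      by (simp_all add: inner_simps)
    then show ?thesis
      by (simp only: cos_diff cos_add) (simp add: field_simps)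
  qed
  show ?case
    unfolding eq by (intro trig_poly.intros)
next
  case (add \<phi> \<psi>)
  then show ?case
    by (simp add: ring_distribs trig_poly.add)
qed

lemma trig_poly_mult:
  assumes "trig_poly \<phi>" and "trig_poly \<psi>"
  shows "trig_poly (\<lambda>x. \<phi> x * \<psi> x)"
  using assms
  by (induction) (auto simp: ring_distribs intro: trig_poly_wave_mult trig_poly.add)

lemma trig_poly_continuous_bounded:
  "trig_poly \<phi> \<Longrightarrow> continuous_on UNIV \<phi> \<and> (\<exists>B. \<forall>x. \<bar>\<phi> x\<bar> \<le> B)"
proof (induction rule: trig_poly.induct)
  case (wave a t s)
  have "\<bar>a * cos (t \<bullet> x + s)\<bar> \<le> \<bar>a\<bar>" for x
    by (simp add: abs_mult mult_left_le)
  then show ?case by (auto intro!: continuous_intros)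
next
  case (add \<phi> \<psi>)
  then obtain B C where "\<And>x. \<bar>\<phi> x\<bar> \<le> B" "\<And>x. \<bar>\<psi> x\<bar> \<le> C" by blast
  then have "\<bar>\<phi> x + \<psi> x\<bar> \<le> B + C" for x
    by (meson abs_triangle_ineq add_mono order_trans)
  with add show ?case by (auto intro!: continuous_intros)
qed

text \<open>Each coordinate sine is a wave, and products of waves are sums of waves, so every
  polynomial in the coordinate sines is a trigonometric polynomial.\<close>

lemma trig_poly_polynomial_in_sines:
  fixes q :: "'a::euclidean_space \<Rightarrow> real"
  assumes "real_polynomial_function q"
  shows "trig_poly (\<lambda>x. q (\<Sum>b\<in>Basis. sin (c * (x \<bullet> b)) *\<^sub>R b))"
  using assms
proof induction
  case (linear f)
  have eq: "f (\<Sum>b\<in>Basis. sin (c * (x \<bullet> b)) *\<^sub>R b) =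
      (\<Sum>b\<in>Basis. f b * cos ((c *\<^sub>R b) \<bullet> x + (- (pi / 2))))" for x
    using linear
    by (simp add: bounded_linear.linear linear_sum linear_cmul sin_cos_eq inner_commute mult.commute
          cos_minus[of "c * _ - pi / 2", symmetric] del: cos_minus)
  show ?case
    unfolding eq by (intro trig_poly_sum trig_poly.wave finite_Basis)
qed (auto intro: trig_poly_const trig_poly.add trig_poly_mult)

text \<open>A merely local uniform approximation of \<open>h\<close> would be useless for convergence in distribution,
  because the sup norm of the approximant could grow with its accuracy and would then multiply the
  tail probabilities. Here it is not: on the cube of half-width \<open>L\<close> the map
  \<open>x \<mapsto> sin (\<pi> x / (2 L))\<close> is coordinatewise injective, so \<open>h\<close> factors there through the compact
  cube \<open>[-1, 1]\<close> as a function \<open>H\<close>; Stone--Weierstrass on \<open>[-1, 1]\<close> gives a polynomial \<open>q\<close>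
  near \<open>H\<close>; and \<open>q\<close> after the sine map stays within \<open>e\<close> of values of \<open>h\<close> on the whole space,
  since the sines never leave \<open>[-1, 1]\<close>. Outside the cube the error is at most \<open>2 B + e\<close>, and there
  the sum of cutoffs is at least \<open>1\<close>.\<close>

lemma trig_poly_approximation:
  fixes h :: "'a::euclidean_space \<Rightarrow> real"
  assumes h: "continuous_on UNIV h" and B: "\<And>x. \<bar>h x\<bar> \<le> B" and L: "L > 0" and e: "e > 0"
  obtains \<phi> where "trig_poly \<phi>"
    and "\<And>x. \<bar>h x - \<phi> x\<bar> \<le> e + 2 * B * (\<Sum>b\<in>Basis. min 1 (\<bar>x \<bullet> b\<bar> / L))"
proof -
  \<comment> \<open>On \<open>[-L, L]\<close> the argument \<open>c * x\<close> runs through \<open>[-\<pi>/2, \<pi>/2]\<close>, where \<open>arcsin\<close> inverts \<open>sin\<close>.\<close>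
  define c where "c = pi / (2 * L)"
  define U :: "'a set" where "U = cbox (- One) One"
  define H where "H u = h (\<Sum>b\<in>Basis. (arcsin (u \<bullet> b) / c) *\<^sub>R b)" for u
  have c: "c > 0" using L by (simp add: c_def)
  have "continuous_on U H"
    unfolding H_def using c
    by (intro continuous_on_compose2[OF h] continuous_intros continuous_on_arcsin)
       (auto simp: U_def mem_box)
  then obtain q where q: "real_polynomial_function q" "\<And>u. u \<in> U \<Longrightarrow> \<bar>H u - q u\<bar> < e"
    using Stone_Weierstrass_real_polynomial_function[of U H e] e by (auto simp: U_def)
  define S where "S x = (\<Sum>b\<in>Basis. sin (c * (x \<bullet> b)) *\<^sub>R b)" for x :: 'a
  have S: "S x \<bullet> b = sin (c * (x \<bullet> b))" if "b \<in> Basis" for x b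
    using that by (simp add: S_def inner_sum_left inner_Basis if_distrib cong: if_cong)
  have SU: "S x \<in> U" for x
    by (simp add: U_def mem_box S)
  have B0: "B \<ge> 0" using B[of 0] by linarith
  have "\<bar>h x - q (S x)\<bar> \<le> e + 2 * B * (\<Sum>b\<in>Basis. min 1 (\<bar>x \<bullet> b\<bar> / L))" for x
  proof (cases "\<forall>b\<in>Basis. \<bar>x \<bullet> b\<bar> \<le> L")
    case True
    have "arcsin (S x \<bullet> b) / c = x \<bullet> b" if "b \<in> Basis" for b
    proof -
      have "\<bar>c * (x \<bullet> b)\<bar> \<le> c * L"
        using True that c by (simp add: abs_mult)
      then have "\<bar>c * (x \<bullet> b)\<bar> \<le> pi / 2"
        using L by (simp add: c_def)
      then show ?thesis
        using that c by (simp add: S abs_le_iff arcsin_sin)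
    qed
    then have "H (S x) = h x"
      by (simp add: H_def euclidean_representation)
    then have "\<bar>h x - q (S x)\<bar> \<le> e"
      using q(2)[OF SU[of x]] by simp
    moreover have "0 \<le> 2 * B * (\<Sum>b\<in>Basis. min 1 (\<bar>x \<bullet> b\<bar> / L))"
      using B0 L by (intro mult_nonneg_nonneg sum_nonneg) auto
    ultimately show ?thesis by linarith
  next
    case False
    then obtain b where b: "b \<in> Basis" "\<bar>x \<bullet> b\<bar> > L" by force
    have "1 = min 1 (\<bar>x \<bullet> b\<bar> / L)"
      using b L by (simp add: min_def field_simps)
    also have "\<dots> \<le> (\<Sum>b\<in>Basis. min 1 (\<bar>x \<bullet> b\<bar> / L))"
      using b L by (intro member_le_sum) auto
    finally have "2 * B \<le> 2 * B * (\<Sum>b\<in>Basis. min 1 (\<bar>x \<bullet> b\<bar> / L))"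
      using B0 mult_left_mono[of 1 _ "2 * B"] by simp
    moreover have "\<bar>H (S x)\<bar> \<le> B"
      unfolding H_def by (rule B)
    ultimately show ?thesis
      using B[of x] q(2)[OF SU[of x]] by linarith
  qed
  with trig_poly_polynomial_in_sines[OF q(1), of c] show thesis
    by (intro that[of "\<lambda>x. q (S x)"]) (simp_all add: S_def)
qed

section \<open>The Cramer--Wold device\<close>

lemma (in prob_space) integrable_bounded_real:
  fixes f :: "'a \<Rightarrow> real"
  assumes "f \<in> borel_measurable M" and "\<And>x. \<bar>f x\<bar> \<le> B"
  shows "integrable M f"
  using assms by (intro integrable_const_bound[where B = B]) auto

text \<open>The test functions used throughout: the Lipschitz bound makes them insensitive to
  perturbations that are small in probability. They include the waves and the cutoffs that occur in
  the trigonometric approximation.\<close>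

definition bounded_lipschitz :: "('a::metric_space \<Rightarrow> real) \<Rightarrow> bool" where
  "bounded_lipschitz \<phi> \<longleftrightarrow> (\<forall>x. \<bar>\<phi> x\<bar> \<le> 1) \<and> (\<exists>C. C-lipschitz_on UNIV \<phi>)"

lemma bounded_lipschitz_continuous: "bounded_lipschitz \<phi> \<Longrightarrow> continuous_on UNIV \<phi>"
  by (auto simp: bounded_lipschitz_def lipschitz_on_continuous_on)

lemma bounded_lipschitz_measurable: "bounded_lipschitz \<phi> \<Longrightarrow> \<phi> \<in> borel_measurable borel"
  by (intro borel_measurable_continuous_onI bounded_lipschitz_continuous)

lemma bounded_lipschitz_cos: "bounded_lipschitz (\<lambda>y::real. cos (y + s))"
proof -
  have "\<bar>cos (x + s) - cos (y + s)\<bar> \<le> \<bar>x - y\<bar>" for x y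
  proof -
    have "\<bar>cos (x + s) - cos (y + s)\<bar>
        = 2 * \<bar>sin ((x + s + (y + s)) / 2)\<bar> * \<bar>sin ((y + s - (x + s)) / 2)\<bar>"
      by (simp add: cos_diff_cos abs_mult)
    also have "\<dots> \<le> 2 * 1 * \<bar>(y + s - (x + s)) / 2\<bar>"
      by (intro mult_mono abs_sin_x_le_abs_x) auto
    finally show ?thesis by simp
  qed
  then have "1-lipschitz_on UNIV (\<lambda>y::real. cos (y + s))"
    by (intro lipschitz_onI) (auto simp: dist_real_def)
  then show ?thesis by (auto simp: bounded_lipschitz_def)
qed

lemma bounded_lipschitz_cutoff:
  assumes "L > 0"
  shows "bounded_lipschitz (\<lambda>y::'a::real_normed_vector. min 1 (norm y / L))"
proof -
  have "\<bar>min 1 (norm x / L) - min 1 (norm y / L)\<bar> \<le> 1 / L * norm (x - y)" for x y :: 'a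
  proof -
    have "\<bar>min 1 (norm x / L) - min 1 (norm y / L)\<bar> \<le> \<bar>norm x / L - norm y / L\<bar>"
      by linarith
    also have "\<dots> = \<bar>norm x - norm y\<bar> / L"
      using assms by (simp flip: diff_divide_distrib)
    also have "\<dots> \<le> norm (x - y) / L"
      using assms by (intro divide_right_mono norm_triangle_ineq3) auto
    finally show ?thesis by simp
  qed
  then have "(1 / L)-lipschitz_on UNIV (\<lambda>y::'a. min 1 (norm y / L))"
    using assms by (intro lipschitz_onI) (auto simp: dist_norm dist_real_def)
  then show ?thesis using assms by (auto simp: bounded_lipschitz_def)
qed

text \<open>The Cramer--Wold device. The hypothesis settles convergence for single waves, hence for
  trigonometric polynomials. For a bounded continuous \<open>h\<close>, the error of a trigonometric
  approximation is controlled by expectations of coordinate cutoffs, which are again functions of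
  one linear functional: they are small under \<open>N\<close> for a large half-width \<open>L\<close>, and by hypothesis
  also under the laws of \<open>Y n\<close> for large \<open>n\<close>.\<close>

theorem cramer_wold:
  fixes Y :: "nat \<Rightarrow> 'w \<Rightarrow> 'a::euclidean_space"
  assumes P: "prob_space P" and Y [measurable]: "\<And>n. Y n \<in> borel_measurable P"
    and N: "prob_space N" and sets_N [measurable_cong]: "sets N = sets borel"
    and conv: "\<And>t \<phi>. bounded_lipschitz \<phi> \<Longrightarrow>
      (\<lambda>n. \<integral>w. \<phi> (t \<bullet> Y n w) \<partial>P) \<longlonglongrightarrow> (\<integral>y. \<phi> (t \<bullet> y) \<partial>N)"
  shows "converges_in_distribution P Y N"
proof -
  interpret P: prob_space P by fact
  interpret N: prob_space N by fact
  have trig: "(\<lambda>n. \<integral>w. \<phi> (Y n w) \<partial>P) \<longlonglongrightarrow> (\<integral>y. \<phi> y \<partial>N)" if "trig_poly \<phi>" for \<phi>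
    using that
  proof induction
    case (wave a t s)
    show ?case
      using tendsto_mult_left[OF conv[OF bounded_lipschitz_cos[of s], of t], of a] by simp
  next
    case (add \<phi> \<psi>)
    obtain B C where B: "continuous_on UNIV \<phi>" "\<And>x. \<bar>\<phi> x\<bar> \<le> B"
      and C: "continuous_on UNIV \<psi>" "\<And>x. \<bar>\<psi> x\<bar> \<le> C"
      using trig_poly_continuous_bounded[OF add.hyps(1)] trig_poly_continuous_bounded[OF add.hyps(2)]
      by blast
    have [measurable]: "\<phi> \<in> borel_measurable borel" "\<psi> \<in> borel_measurable borel"
      using B C by (auto intro: borel_measurable_continuous_onI)
    have "integrable P (\<lambda>w. \<phi> (Y n w))" "integrable P (\<lambda>w. \<psi> (Y n w))" for n
      by (rule P.integrable_bounded_real, measurable, fact)+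
    moreover have "integrable N \<phi>" "integrable N \<psi>"
      by (rule N.integrable_bounded_real, measurable, fact)+
    ultimately show ?case
      using add by (simp add: tendsto_add)
  qed
  have "(\<lambda>n. \<integral>w. h (Y n w) \<partial>P) \<longlonglongrightarrow> (\<integral>y. h y \<partial>N)"
    if h: "continuous_on UNIV h" "bounded (range h)" for h :: "'a \<Rightarrow> real"
  proof (rule tendstoI)
    fix \<epsilon> :: real assume \<epsilon>: "\<epsilon> > 0"
    obtain B where B: "\<And>x. \<bar>h x\<bar> \<le> B"
      using h(2) by (auto simp: bounded_iff)
    have B0: "B \<ge> 0" using B[of 0] by linarith
    have [measurable]: "h \<in> borel_measurable borel"
      using h by (auto intro: borel_measurable_continuous_onI)
    have "(\<lambda>m. 2 * B * (\<Sum>b\<in>Basis. \<integral>y. min 1 (\<bar>b \<bullet> y\<bar> / real (Suc m)) \<partial>N))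
        \<longlonglongrightarrow> 2 * B * (\<Sum>b\<in>(Basis :: 'a set). \<integral>y. 0 \<partial>N)"
    proof (intro tendsto_intros integral_dominated_convergence[where w = "\<lambda>_. 1"] AE_I2)
      fix b y :: 'a
      have "(\<lambda>m. \<bar>b \<bullet> y\<bar> / real (Suc m)) \<longlonglongrightarrow> 0"
        by (rule LIMSEQ_Suc[OF lim_const_over_n])
      then show "(\<lambda>m. min 1 (\<bar>b \<bullet> y\<bar> / real (Suc m))) \<longlonglongrightarrow> 0"
        using tendsto_min[OF tendsto_const[of 1]] by fastforce
    qed (auto simp: min_def)
    then have "eventually (\<lambda>m. 2 * B * (\<Sum>b\<in>(Basis :: 'a set). \<integral>y. min 1 (\<bar>b \<bullet> y\<bar> / real (Suc m)) \<partial>N)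
        < \<epsilon> / 5) sequentially"
      by (rule order_tendstoD) (use \<epsilon> in auto)
    then obtain m where
      "2 * B * (\<Sum>b\<in>(Basis :: 'a set). \<integral>y. min 1 (\<bar>b \<bullet> y\<bar> / real (Suc m)) \<partial>N) < \<epsilon> / 5"
      by (auto simp: eventually_sequentially)
    moreover define L where "L = real (Suc m)"
    ultimately have L: "L > 0"
      and tail_N: "2 * B * (\<Sum>b\<in>(Basis :: 'a set). \<integral>y. min 1 (\<bar>b \<bullet> y\<bar> / L) \<partial>N) < \<epsilon> / 5"
      by auto
    obtain \<phi> where \<phi>: "trig_poly \<phi>"
      and approx: "\<And>x. \<bar>h x - \<phi> x\<bar> \<le> \<epsilon> / 5 + 2 * B * (\<Sum>b\<in>Basis. min 1 (\<bar>b \<bullet> x\<bar> / L))"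
      using trig_poly_approximation[OF h(1) B L, of "\<epsilon> / 5"] \<epsilon> by (auto simp: inner_commute)
    obtain C where C: "continuous_on UNIV \<phi>" "\<And>x. \<bar>\<phi> x\<bar> \<le> C"
      using trig_poly_continuous_bounded[OF \<phi>] by blast
    have [measurable]: "\<phi> \<in> borel_measurable borel"
      using C by (auto intro: borel_measurable_continuous_onI)
    have gap: "\<bar>(\<integral>w. h (Z w) \<partial>Q) - (\<integral>w. \<phi> (Z w) \<partial>Q)\<bar>
        \<le> \<epsilon> / 5 + 2 * B * (\<Sum>b\<in>Basis. \<integral>w. min 1 (\<bar>b \<bullet> Z w\<bar> / L) \<partial>Q)"
      if Q: "prob_space Q" and Z [measurable]: "Z \<in> borel_measurable Q" for Q :: "'c measure" and Z
    proof -
      interpret Q: prob_space Q by fact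
      have int: "integrable Q (\<lambda>w. h (Z w))" "integrable Q (\<lambda>w. \<phi> (Z w))"
        by (rule Q.integrable_bounded_real, measurable, fact)+
      have int': "integrable Q (\<lambda>w. min 1 (\<bar>b \<bullet> Z w\<bar> / L))" for b
        using L by (intro Q.integrable_bounded_real[where B = 1]) (auto simp: min_def)
      have "\<bar>(\<integral>w. h (Z w) \<partial>Q) - (\<integral>w. \<phi> (Z w) \<partial>Q)\<bar> = \<bar>\<integral>w. h (Z w) - \<phi> (Z w) \<partial>Q\<bar>"
        using int by simp
      also have "\<dots> \<le> (\<integral>w. \<bar>h (Z w) - \<phi> (Z w)\<bar> \<partial>Q)"
        by (rule integral_abs_bound)
      also have "\<dots> \<le> (\<integral>w. \<epsilon> / 5 + 2 * B * (\<Sum>b\<in>Basis. min 1 (\<bar>b \<bullet> Z w\<bar> / L)) \<partial>Q)"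
        using int int' approx by (intro integral_mono) auto
      also have "\<dots> = \<epsilon> / 5 + 2 * B * (\<Sum>b\<in>Basis. \<integral>w. min 1 (\<bar>b \<bullet> Z w\<bar> / L) \<partial>Q)"
        using int' by (simp add: Q.prob_space)
      finally show ?thesis .
    qed
    have "(\<lambda>n. 2 * B * (\<Sum>b\<in>(Basis :: 'a set). \<integral>w. min 1 (\<bar>b \<bullet> Y n w\<bar> / L) \<partial>P))
        \<longlonglongrightarrow> 2 * B * (\<Sum>b\<in>(Basis :: 'a set). \<integral>y. min 1 (\<bar>b \<bullet> y\<bar> / L) \<partial>N)"
      using conv[OF bounded_lipschitz_cutoff[OF L]] by (intro tendsto_intros) auto
    from order_tendstoD(2)[OF this tail_N]
    have "eventually (\<lambda>n. 2 * B * (\<Sum>b\<in>(Basis :: 'a set). \<integral>w. min 1 (\<bar>b \<bullet> Y n w\<bar> / L) \<partial>P) < \<epsilon> / 5)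
        sequentially" .
    moreover have "eventually (\<lambda>n. dist (\<integral>w. \<phi> (Y n w) \<partial>P) (\<integral>y. \<phi> y \<partial>N) < \<epsilon> / 5) sequentially"
      by (rule tendstoD[OF trig[OF \<phi>]]) (use \<epsilon> in simp)
    ultimately show "eventually (\<lambda>n. dist (\<integral>w. h (Y n w) \<partial>P) (\<integral>y. h y \<partial>N) < \<epsilon>) sequentially"
    proof (eventually_elim)
      case (elim n)
      moreover have "(\<lambda>y. y) \<in> borel_measurable N" by simp
      ultimately show ?case
        using gap[OF P Y[of n]] gap[OF N, of "\<lambda>y. y"] tail_N \<epsilon>
        unfolding dist_real_def by linarith
    qed
  qed
  then show ?thesis
    using N sets_N Y by (auto simp: converges_in_distribution_def)
qed

section \<open>Slutsky's theorem and tightness\<close>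

lemma bounded_lipschitz_inner:
  fixes \<phi> :: "real \<Rightarrow> real" and t :: "'a::real_inner"
  assumes "bounded_lipschitz \<phi>"
  shows "bounded_lipschitz (\<lambda>x. \<phi> (t \<bullet> x))"
proof -
  obtain C where C: "C-lipschitz_on UNIV \<phi>" and B: "\<And>x. \<bar>\<phi> x\<bar> \<le> 1"
    using assms by (auto simp: bounded_lipschitz_def)
  have C0: "C \<ge> 0" using lipschitz_on_nonneg[OF C] .
  have "dist (\<phi> (t \<bullet> x)) (\<phi> (t \<bullet> y)) \<le> C * norm t * dist x y" for x y
  proof -
    have "dist (\<phi> (t \<bullet> x)) (\<phi> (t \<bullet> y)) \<le> C * dist (t \<bullet> x) (t \<bullet> y)"
      using lipschitz_onD[OF C] by simp
    also have "dist (t \<bullet> x) (t \<bullet> y) = \<bar>t \<bullet> (x - y)\<bar>"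
      by (simp add: dist_real_def inner_diff_right)
    also have "C * \<bar>t \<bullet> (x - y)\<bar> \<le> C * (norm t * norm (x - y))"
      using C0 by (intro mult_left_mono Cauchy_Schwarz_ineq2)
    finally show ?thesis by (simp add: dist_norm mult.assoc)
  qed
  then have "(C * norm t)-lipschitz_on UNIV (\<lambda>x. \<phi> (t \<bullet> x))"
    using C0 by (intro lipschitz_onI) auto
  with B show ?thesis by (auto simp: bounded_lipschitz_def)
qed

text \<open>If \<open>\<phi>\<close> is \<open>C\<close>-Lipschitz and bounded by \<open>1\<close>, the two expectations differ by at most
  \<open>C \<delta>\<close> plus twice the probability that the vectors are more than \<open>\<delta>\<close> apart.\<close>

lemma slutsky_bounded_lipschitz:
  fixes U V :: "nat \<Rightarrow> 'w \<Rightarrow> 'a::{real_normed_vector, second_countable_topology}"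
  assumes P: "prob_space P"
    and [measurable]: "\<And>n. U n \<in> borel_measurable P" "\<And>n. V n \<in> borel_measurable P"
    and diff: "converges_in_prob P (\<lambda>n w. U n w - V n w) 0"
    and \<phi>: "bounded_lipschitz \<phi>"
    and lim: "(\<lambda>n. \<integral>w. \<phi> (V n w) \<partial>P) \<longlonglongrightarrow> l"
  shows "(\<lambda>n. \<integral>w. \<phi> (U n w) \<partial>P) \<longlonglongrightarrow> l"
proof -
  interpret P: prob_space P by fact
  obtain C where C: "C-lipschitz_on UNIV \<phi>" and B: "\<And>x. \<bar>\<phi> x\<bar> \<le> 1"
    using \<phi> by (auto simp: bounded_lipschitz_def)
  have C0: "C \<ge> 0" using lipschitz_on_nonneg[OF C] .
  have [measurable]: "\<phi> \<in> borel_measurable borel"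
    by (rule bounded_lipschitz_measurable[OF \<phi>])
  have int: "integrable P (\<lambda>w. \<phi> (U n w))" "integrable P (\<lambda>w. \<phi> (V n w))" for n
    by (rule P.integrable_bounded_real, measurable, rule B)+
  define A where "A \<delta> n = {w \<in> space P. norm (U n w - V n w) > \<delta>}" for \<delta> n
  have [measurable]: "A \<delta> n \<in> sets P" for \<delta> n
    unfolding A_def by measurable
  have A: "(\<lambda>n. measure P (A \<delta> n)) \<longlonglongrightarrow> 0" if "\<delta> > 0" for \<delta>
    using diff that by (simp add: converges_in_prob_def A_def)
  have "(\<lambda>n. (\<integral>w. \<phi> (U n w) \<partial>P) - (\<integral>w. \<phi> (V n w) \<partial>P)) \<longlonglongrightarrow> 0"
  proof (rule tendstoI)
    fix \<epsilon> :: real assume \<epsilon>: "\<epsilon> > 0"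
    define \<delta> where "\<delta> = \<epsilon> / (2 * (C + 1))"
    have \<delta>: "\<delta> > 0" and C\<delta>: "C * \<delta> \<le> \<epsilon> / 2"
      using \<epsilon> C0 by (auto simp: \<delta>_def field_simps)
    have "eventually (\<lambda>n. measure P (A \<delta> n) < \<epsilon> / 4) sequentially"
      by (rule order_tendstoD(2)[OF A[OF \<delta>]]) (use \<epsilon> in simp)
    then show "eventually (\<lambda>n. dist ((\<integral>w. \<phi> (U n w) \<partial>P) - (\<integral>w. \<phi> (V n w) \<partial>P)) 0 < \<epsilon>) sequentially"
    proof eventually_elim
      case (elim n)
      have "\<bar>\<phi> (U n w) - \<phi> (V n w)\<bar> \<le> C * \<delta> + 2 * indicator (A \<delta> n) w" if "w \<in> space P" for w
      proof (cases "w \<in> A \<delta> n")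
        case True
        have "0 \<le> C * \<delta>" using C0 \<delta> by simp
        then show ?thesis using True B[of "U n w"] B[of "V n w"] by simp
      next
        case False
        then have "norm (U n w - V n w) \<le> \<delta>" using that by (auto simp: A_def)
        moreover have "\<bar>\<phi> (U n w) - \<phi> (V n w)\<bar> \<le> C * norm (U n w - V n w)"
          using lipschitz_onD[OF C, of "U n w" "V n w"] by (simp add: dist_norm)
        ultimately have "\<bar>\<phi> (U n w) - \<phi> (V n w)\<bar> \<le> C * \<delta>"
          using C0 mult_left_mono order_trans by blast
        then show ?thesis using False by simp
      qed
      moreover have "integrable P (\<lambda>w. C * \<delta> + 2 * indicator (A \<delta> n) w)"
        by (rule P.integrable_bounded_real[where B = "C * \<delta> + 2"])
           (use C0 \<delta> in \<open>auto simp: indicator_def\<close>)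
      ultimately have "(\<integral>w. \<bar>\<phi> (U n w) - \<phi> (V n w)\<bar> \<partial>P) \<le> (\<integral>w. C * \<delta> + 2 * indicator (A \<delta> n) w \<partial>P)"
        using int by (intro integral_mono) auto
      also have "\<dots> = C * \<delta> + 2 * measure P (A \<delta> n)"
      proof -
        have "integrable P (indicator (A \<delta> n) :: _ \<Rightarrow> real)"
          by (rule P.integrable_bounded_real[where B = 1]) (auto simp: indicator_def)
        then show ?thesis by (simp add: P.prob_space)
      qed
      finally have "(\<integral>w. \<bar>\<phi> (U n w) - \<phi> (V n w)\<bar> \<partial>P) < \<epsilon>"
        using elim C\<delta> by linarith
      moreover have "\<bar>(\<integral>w. \<phi> (U n w) \<partial>P) - (\<integral>w. \<phi> (V n w) \<partial>P)\<bar> \<le> (\<integral>w. \<bar>\<phi> (U n w) - \<phi> (V n w)\<bar> \<partial>P)"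
        using int by (simp add: integral_abs_bound flip: Bochner_Integration.integral_diff)
      ultimately show ?case by simp
    qed
  qed
  from tendsto_add[OF this lim] show ?thesis by simp
qed

theorem slutsky:
  fixes U V :: "nat \<Rightarrow> 'w \<Rightarrow> 'a::euclidean_space"
  assumes P: "prob_space P" and U: "\<And>n. U n \<in> borel_measurable P"
    and V: "converges_in_distribution P V N"
    and diff: "converges_in_prob P (\<lambda>n w. U n w - V n w) 0"
  shows "converges_in_distribution P U N"
proof (rule cramer_wold[OF P U])
  show "prob_space N" "sets N = sets borel"
    using V by (auto simp: converges_in_distribution_def)
  fix t :: 'a and \<phi> :: "real \<Rightarrow> real" assume \<phi>: "bounded_lipschitz \<phi>"
  let ?\<phi> = "\<lambda>x. \<phi> (t \<bullet> x)"
  have \<phi>': "bounded_lipschitz ?\<phi>" by (rule bounded_lipschitz_inner[OF \<phi>])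
  then have "continuous_on UNIV ?\<phi> \<and> bounded (range ?\<phi>)"
    by (auto simp: bounded_lipschitz_continuous bounded_iff) (auto simp: bounded_lipschitz_def)
  then have "(\<lambda>n. \<integral>w. ?\<phi> (V n w) \<partial>P) \<longlonglongrightarrow> (\<integral>y. ?\<phi> y \<partial>N)"
    using V unfolding converges_in_distribution_def by blast
  with \<phi>' diff U V show "(\<lambda>n. \<integral>w. ?\<phi> (U n w) \<partial>P) \<longlonglongrightarrow> (\<integral>y. ?\<phi> y \<partial>N)"
    by (intro slutsky_bounded_lipschitz[OF P _ _ diff \<phi>']) (auto simp: converges_in_distribution_def)
qed

text \<open>The indicator of the tail is dominated by the cutoff \<open>min 1 (norm y / L)\<close>, a bounded
  continuous function whose expectation under the limit law vanishes as \<open>L\<close> grows.\<close>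

lemma converges_in_distribution_tight:
  fixes V :: "nat \<Rightarrow> 'w \<Rightarrow> 'a::euclidean_space"
  assumes P: "prob_space P" and V: "converges_in_distribution P V N" and \<epsilon>: "\<epsilon> > 0"
  obtains L where "L > 0"
    and "eventually (\<lambda>n. measure P {w \<in> space P. norm (V n w) > L} < \<epsilon>) sequentially"
proof -
  interpret P: prob_space P by fact
  interpret N: prob_space N using V by (simp add: converges_in_distribution_def)
  have [measurable]: "V n \<in> borel_measurable P" for n
    using V by (simp add: converges_in_distribution_def)
  have sets_N [measurable_cong]: "sets N = sets borel"
    using V by (simp add: converges_in_distribution_def)
  have "(\<lambda>m. \<integral>y. min 1 (norm y / real (Suc m)) \<partial>N) \<longlonglongrightarrow> (\<integral>y. 0 \<partial>N)"
  proof (intro integral_dominated_convergence[where w = "\<lambda>_. 1"] AE_I2)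
    fix y :: 'a
    have "(\<lambda>m. norm y / real (Suc m)) \<longlonglongrightarrow> 0"
      by (rule LIMSEQ_Suc[OF lim_const_over_n])
    then show "(\<lambda>m. min 1 (norm y / real (Suc m))) \<longlonglongrightarrow> 0"
      using tendsto_min[OF tendsto_const[of 1]] by fastforce
  qed (auto simp: min_def)
  then have "eventually (\<lambda>m. (\<integral>y. min 1 (norm y / real (Suc m)) \<partial>N) < \<epsilon>) sequentially"
    by (rule order_tendstoD) (use \<epsilon> in auto)
  then obtain m where "(\<integral>y. min 1 (norm y / real (Suc m)) \<partial>N) < \<epsilon>"
    by (auto simp: eventually_sequentially)
  moreover define L where "L = real (Suc m)"
  ultimately have L: "L > 0" and tail: "(\<integral>y. min 1 (norm y / L) \<partial>N) < \<epsilon>"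
    by auto
  have "bounded_lipschitz (\<lambda>y::'a. min 1 (norm y / L))"
    by (rule bounded_lipschitz_cutoff[OF L])
  then have "continuous_on UNIV (\<lambda>y::'a. min 1 (norm y / L))"
      "bounded (range (\<lambda>y::'a. min 1 (norm y / L)))"
    by (auto simp: bounded_lipschitz_continuous bounded_iff) (auto simp: bounded_lipschitz_def)
  then have "(\<lambda>n. \<integral>w. min 1 (norm (V n w) / L) \<partial>P) \<longlonglongrightarrow> (\<integral>y. min 1 (norm y / L) \<partial>N)"
    using V unfolding converges_in_distribution_def by blast
  from order_tendstoD(2)[OF this tail]
  have "eventually (\<lambda>n. measure P {w \<in> space P. norm (V n w) > L} < \<epsilon>) sequentially"
  proof eventually_elim
    case (elim n)
    have "measure P {w \<in> space P. norm (V n w) > L}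
        = (\<integral>w. indicator {w \<in> space P. norm (V n w) > L} w \<partial>P)"
      by simp
    also have "\<dots> \<le> (\<integral>w. min 1 (norm (V n w) / L) \<partial>P)"
      using L by (intro integral_mono P.integrable_bounded_real[where B = 1])
                 (auto simp: indicator_def min_def field_simps)
    finally show ?case using elim by simp
  qed
  with L show thesis by (rule that)
qed

text \<open>By tightness, dividing by \<open>sqrt n\<close> kills a sequence that converges in distribution. This is how
  the law of large numbers is obtained from the central limit theorem.\<close>

lemma converges_in_prob_scaled:
  fixes V :: "nat \<Rightarrow> 'w \<Rightarrow> 'a::euclidean_space"
  assumes P: "prob_space P" and V: "converges_in_distribution P V N"
  shows "converges_in_prob P (\<lambda>n w. V n w /\<^sub>R sqrt (real n)) 0"
  unfolding converges_in_prob_def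
proof (intro allI impI)
  interpret P: prob_space P by fact
  have [measurable]: "V n \<in> borel_measurable P" for n
    using V by (simp add: converges_in_distribution_def)
  fix e :: real assume e: "e > 0"
  show "(\<lambda>n. measure P {w \<in> space P. e < dist (V n w /\<^sub>R sqrt (real n)) 0}) \<longlonglongrightarrow> 0"
  proof (rule tendstoI)
    fix \<epsilon> :: real assume "\<epsilon> > 0"
    then obtain L where L: "L > 0"
      and tail: "eventually (\<lambda>n. measure P {w \<in> space P. norm (V n w) > L} < \<epsilon>) sequentially"
      by (rule converges_in_distribution_tight[OF P V])
    have "filterlim (\<lambda>n. sqrt (real n)) at_top sequentially"
      by (intro filterlim_compose[OF sqrt_at_top] filterlim_real_sequentially)
    then have "eventually (\<lambda>n. L / e \<le> sqrt (real n)) sequentially"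
      by (simp add: filterlim_at_top)
    with tail show "eventually (\<lambda>n. dist (measure P {w \<in> space P. e < dist (V n w /\<^sub>R sqrt (real n)) 0}) 0 < \<epsilon>)
        sequentially"
    proof eventually_elim
      case (elim n)
      have pos: "sqrt (real n) > 0"
        using elim(2) L e by (meson divide_pos_pos less_le_trans)
      have "{w \<in> space P. e < dist (V n w /\<^sub>R sqrt (real n)) 0} \<subseteq> {w \<in> space P. norm (V n w) > L}"
      proof safe
        fix w assume "e < dist (V n w /\<^sub>R sqrt (real n)) 0"
        then have "e * sqrt (real n) < norm (V n w)"
          using pos by (simp add: field_simps)
        moreover have "L \<le> e * sqrt (real n)"
          using elim(2) e by (simp add: field_simps)
        ultimately show "norm (V n w) > L" by linarith
      qed
      then have "measure P {w \<in> space P. e < dist (V n w /\<^sub>R sqrt (real n)) 0}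
          \<le> measure P {w \<in> space P. norm (V n w) > L}"
        by (intro P.finite_measure_mono) auto
      with elim(1) show ?case by simp
    qed
  qed
qed

section \<open>Gaussian laws\<close>

lemma sets_normal_law [simp, measurable_cong]: "sets (normal_law m v) = sets borel"
  by (simp add: normal_law_def)

lemma distr_std_normal_scale:
  assumes "\<sigma> > 0"
  shows "distr std_normal_distribution borel (\<lambda>x. \<sigma> * x) = normal_law 0 (\<sigma>\<^sup>2)"
proof -
  interpret prob_space std_normal_distribution
    by (rule prob_space_normal_density) simp
  have "distributed std_normal_distribution lborel (\<lambda>x. x) std_normal_density"
    by (auto simp: distributed_def distr_id2)
  then have "distributed std_normal_distribution lborel (\<lambda>x. 0 + \<sigma> * x) (normal_density (0 + \<sigma> * 0) (\<bar>\<sigma>\<bar> * 1))"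
    using assms by (intro normal_density_affine) auto
  then show ?thesis
    using assms by (simp add: distributed_def normal_law_def cong: distr_cong)
qed

text \<open>The law of \<open>\<Sum>k\<in>K. \<xi> k *\<^sub>R u k\<close> with independent standard normal \<open>\<xi> k\<close>. Starting from the
  vectors \<open>u k\<close> rather than from a covariance matrix avoids matrix square roots and allows
  degenerate covariances: a functional \<open>t\<close> simply ignores the indices with \<open>t \<bullet> u k = 0\<close>.\<close>

lemma gaussian_law_exists:
  fixes u :: "'k \<Rightarrow> 'a::euclidean_space"
  assumes "finite K"
  obtains N where "prob_space N" and "sets N = sets borel"
    and "\<And>t. distr N borel (\<lambda>x. t \<bullet> x) = normal_law 0 (\<Sum>k\<in>K. (t \<bullet> u k)\<^sup>2)"
proof -
  define G where "G = PiM K (\<lambda>_. std_normal_distribution)"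
  have std: "prob_space std_normal_distribution"
    by (rule prob_space_normal_density) simp
  interpret G: prob_space G
    unfolding G_def by (intro prob_space_PiM std)
  have coord [measurable]: "(\<lambda>\<xi>. \<xi> k) \<in> borel_measurable G" if "k \<in> K" for k
  proof -
    have "(\<lambda>\<xi>. \<xi> k) \<in> measurable G std_normal_distribution"
      unfolding G_def using that by (rule measurable_component_singleton)
    then show ?thesis by simp
  qed
  define N where "N = distr G borel (\<lambda>\<xi>. \<Sum>k\<in>K. \<xi> k *\<^sub>R u k)"
  have [measurable]: "(\<lambda>\<xi>. \<Sum>k\<in>K. \<xi> k *\<^sub>R u k) \<in> borel_measurable G"
    by (intro borel_measurable_sum borel_measurable_scaleR coord) auto
  have law: "distr N borel (\<lambda>x. t \<bullet> x) = normal_law 0 (\<Sum>k\<in>K. (t \<bullet> u k)\<^sup>2)" for t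
  proof -
    define J where "J = {k \<in> K. t \<bullet> u k \<noteq> 0}"
    have J: "finite J" "J \<subseteq> K" using assms by (auto simp: J_def)
    have "distr N borel (\<lambda>x. t \<bullet> x) = distr G borel (\<lambda>\<xi>. \<Sum>k\<in>K. \<xi> k * (t \<bullet> u k))"
      unfolding N_def by (subst distr_distr) (auto simp: o_def inner_sum_right)
    also have "(\<lambda>\<xi>::'k \<Rightarrow> real. \<Sum>k\<in>K. \<xi> k * (t \<bullet> u k)) = (\<lambda>\<xi>. \<Sum>k\<in>J. (t \<bullet> u k) * \<xi> k)"
      using assms by (intro ext sum.mono_neutral_cong_right) (auto simp: J_def)
    also have "distr G borel \<dots> = normal_law 0 (\<Sum>k\<in>J. (t \<bullet> u k)\<^sup>2)"
    proof (cases "J = {}")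
      case True
      have "distr G borel (\<lambda>_. 0::real) = return borel 0"
        by (intro measure_eqI) (auto simp: emeasure_distr indicator_def G.emeasure_space_1)
      then show ?thesis using True by (simp add: normal_law_def)
    next
      case False
      have "G.indep_vars (\<lambda>_. borel) (\<lambda>k \<xi>. \<xi> k) K"
      proof -
        have "G.indep_vars (\<lambda>_. std_normal_distribution) (\<lambda>k \<xi>. \<xi> k) K"
        proof (subst G.indep_vars_iff_distr_eq_PiM')
          have "distr G (PiM K (\<lambda>_. std_normal_distribution)) (\<lambda>\<xi>. \<lambda>k\<in>K. \<xi> k) = distr G G (\<lambda>\<xi>. \<xi>)"
            by (intro distr_cong) (auto simp: G_def space_PiM)
          also have "\<dots> = PiM K (\<lambda>k. distr G std_normal_distribution (\<lambda>\<xi>. \<xi> k))"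
            unfolding G_def distr_id by (intro PiM_cong refl distr_PiM_component[symmetric] std)
          finally show "distr G (PiM K (\<lambda>_. std_normal_distribution)) (\<lambda>\<xi>. \<lambda>k\<in>K. \<xi> k)
              = PiM K (\<lambda>k. distr G std_normal_distribution (\<lambda>\<xi>. \<xi> k))" .
          show "K \<noteq> {}" using False J by auto
        qed (unfold G_def, rule measurable_component_singleton)
        then show ?thesis
          by (rule G.indep_vars_compose2[where Y = "\<lambda>_ x. x"]) auto
      qed
      then have "G.indep_vars (\<lambda>_. borel) (\<lambda>k \<xi>. (t \<bullet> u k) * \<xi> k) J"
        by (intro G.indep_vars_compose2[OF G.indep_vars_subset[OF _ J(2)]]) auto
      moreover have "distributed G lborel (\<lambda>\<xi>. (t \<bullet> u k) * \<xi> k) (normal_density 0 \<bar>t \<bullet> u k\<bar>)"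
        if "k \<in> J" for k
      proof -
        have k: "k \<in> K" "t \<bullet> u k \<noteq> 0" using that by (auto simp: J_def)
        have "distr G lborel (\<lambda>\<xi>. \<xi> k) = distr G std_normal_distribution (\<lambda>\<xi>. \<xi> k)"
          by (rule distr_cong) auto
        also have "\<dots> = std_normal_distribution"
          unfolding G_def using std k(1) by (rule distr_PiM_component)
        finally have "distributed G lborel (\<lambda>\<xi>. \<xi> k) std_normal_density"
          using k coord by (auto simp: distributed_def)
        from G.normal_density_affine[OF this, of "t \<bullet> u k" 0] k show ?thesis by simp
      qed
      ultimately have "distributed G lborel (\<lambda>\<xi>. \<Sum>k\<in>J. (t \<bullet> u k) * \<xi> k)
          (normal_density (\<Sum>k\<in>J. 0) (sqrt (\<Sum>k\<in>J. \<bar>t \<bullet> u k\<bar>\<^sup>2)))"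
        using J False by (intro G.sum_indep_normal) (auto simp: J_def)
      moreover have "(\<Sum>k\<in>J. (t \<bullet> u k)\<^sup>2) > 0"
        using J False by (intro sum_pos) (auto simp: J_def)
      ultimately show ?thesis
        by (simp add: normal_law_def distributed_def cong: distr_cong)
    qed
    also have "(\<Sum>k\<in>J. (t \<bullet> u k)\<^sup>2) = (\<Sum>k\<in>K. (t \<bullet> u k)\<^sup>2)"
      using assms by (intro sum.mono_neutral_left) (auto simp: J_def)
    finally show ?thesis .
  qed
  show thesis
    by (rule that[OF _ _ law]) (auto simp: N_def intro!: G.prob_space_distr)
qed

section \<open>Limit theorems for finitely supported samples\<close>

lemma (in prob_space) indep_sets_reindex:
  assumes F: "indep_sets F (f ` I)" and f: "inj_on f I"
  shows "indep_sets (\<lambda>i. F (f i)) I"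
proof (rule indep_setsI)
  show "F (f i) \<subseteq> events" if "i \<in> I" for i
    using F that by (auto simp: indep_sets_def)
  fix A J assume J: "J \<noteq> {}" "J \<subseteq> I" "finite J" and A: "\<forall>j\<in>J. A j \<in> F (f j)"
  have inj: "inj_on f J" using f J(2) inj_on_subset by blast
  have "prob (\<Inter>j\<in>f ` J. A (the_inv_into J f j)) = (\<Prod>j\<in>f ` J. prob (A (the_inv_into J f j)))"
    using J A inj by (intro indep_setsD[OF F]) (auto simp: the_inv_into_f_f)
  then show "prob (\<Inter>j\<in>J. A j) = (\<Prod>j\<in>J. prob (A j))"
    using inj by (simp add: prod.reindex the_inv_into_f_f)
qed

lemma (in prob_space) indep_vars_reindex:
  "indep_vars N X (f ` I) \<Longrightarrow> inj_on f I \<Longrightarrow> indep_vars (\<lambda>i. N (f i)) (\<lambda>i. X (f i)) I"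
  by (auto simp: indep_vars_def intro: indep_sets_reindex)

text \<open>The classical central limit theorem for functions of a finitely supported sample, with the
  degenerate variance \<open>0\<close> included: the summands then vanish almost surely.\<close>

lemma (in prob_space) central_limit_theorem_bounded_continuous:
  fixes X :: "nat \<Rightarrow> 'a \<Rightarrow> 'k::countable" and \<xi> :: "'k \<Rightarrow> real" and \<phi> :: "real \<Rightarrow> real"
  assumes indep: "indep_vars (\<lambda>_. count_space UNIV) X {1..}"
    and law': "\<forall>i\<ge>1. distr M (count_space UNIV) (X i) = measure_pmf law"
    and fin: "finite (set_pmf law)"
    and mean: "measure_pmf.expectation law \<xi> = 0"
    and \<phi>: "continuous_on UNIV \<phi>" "\<And>x. \<bar>\<phi> x\<bar> \<le> B"
  shows "(\<lambda>n. \<integral>w. \<phi> ((\<Sum>i=1..n. \<xi> (X i w)) / sqrt (real n)) \<partial>M)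
    \<longlonglongrightarrow> (\<integral>y. \<phi> y \<partial>normal_law 0 (measure_pmf.expectation law (\<lambda>k. (\<xi> k)\<^sup>2)))"
proof -
  define v where "v = measure_pmf.expectation law (\<lambda>k. (\<xi> k)\<^sup>2)"
  note law = law'[rule_format]
  have v0: "v \<ge> 0" unfolding v_def by (intro integral_nonneg_AE) auto
  have X [measurable]: "X i \<in> measurable M (count_space UNIV)" if "i \<ge> 1" for i
    using indep that by (auto simp: indep_vars_def)
  have int: "integrable (measure_pmf law) \<zeta>" for \<zeta> :: "'k \<Rightarrow> real"
    by (rule integrable_measure_pmf_finite[OF fin])
  have exp: "(\<integral>w. \<zeta> (X i w) \<partial>M) = measure_pmf.expectation law \<zeta>" if "i \<ge> 1" for i and \<zeta> :: "'k \<Rightarrow> real"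
    by (subst law[OF that, symmetric], subst integral_distr) (use that in auto)
  have intX: "integrable M (\<lambda>w. \<zeta> (X i w))" if "i \<ge> 1" for i and \<zeta> :: "'k \<Rightarrow> real"
    using int[of \<zeta>] unfolding law[OF that, symmetric] by (subst (asm) integrable_distr_eq) (use that in auto)
  have [measurable]: "\<phi> \<in> borel_measurable borel"
    using \<phi> by (auto intro: borel_measurable_continuous_onI)
  show ?thesis
  proof (cases "v = 0")
    case True
    have "AE k in measure_pmf law. (\<xi> k)\<^sup>2 = 0"
      using True int[of "\<lambda>k. (\<xi> k)\<^sup>2"] unfolding v_def by (subst (asm) integral_nonneg_eq_0_iff_AE) auto
    then have "AE k in measure_pmf law. \<xi> k = 0" by simp
    then have null: "AE k in distr M (count_space UNIV) (X i). \<xi> k = 0" if "i \<ge> 1" for i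
      unfolding law[OF that] .
    have "AE w in M. \<xi> (X i w) = 0" if "i \<ge> 1" for i
      by (rule AE_distrD[OF X[OF that] null[OF that]])
    then have "AE w in M. \<forall>i. i \<ge> 1 \<longrightarrow> \<xi> (X i w) = 0"
      by (subst AE_all_countable) (auto intro: AE_impI)
    then have "(\<integral>w. \<phi> ((\<Sum>i=1..n. \<xi> (X i w)) / sqrt (real n)) \<partial>M) = (\<integral>w. \<phi> 0 \<partial>M)" for n
      by (intro integral_cong_AE) (auto intro!: borel_measurable_sum)
    also have "(\<integral>w. \<phi> 0 \<partial>M) = (\<integral>y. \<phi> y \<partial>normal_law 0 v)"
      using True by (simp add: prob_space normal_law_def integral_return)
    finally show ?thesis by (simp add: v_def)
  next
    case False
    define \<sigma> where "\<sigma> = sqrt v"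
    have \<sigma>: "\<sigma> > 0" "\<sigma>\<^sup>2 = v" using False v0 by (auto simp: \<sigma>_def)
    define Y where "Y i w = \<xi> (X (Suc i) w)" for i w
    have "indep_vars (\<lambda>_. count_space UNIV) (\<lambda>i. X (Suc i)) UNIV"
      by (rule indep_vars_reindex[OF indep_vars_subset[OF indep]]) auto
    then have indY: "indep_vars (\<lambda>_. borel) Y UNIV"
      unfolding Y_def by (rule indep_vars_compose2) auto
    have "weak_conv_m (\<lambda>n. distr M borel (\<lambda>w. (\<Sum>i<n. Y i w) / sqrt (real n * \<sigma>\<^sup>2))) std_normal_distribution"
    proof (rule central_limit_theorem_zero_mean[OF indY])
      show "expectation (Y n) = 0" for n
        unfolding Y_def using exp[of "Suc n" \<xi>] mean by simp
      then show "variance (Y n) = \<sigma>\<^sup>2" for n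
        unfolding \<sigma> v_def Y_def using exp[of "Suc n" "\<lambda>k. (\<xi> k)\<^sup>2"] by simp
      show "integrable M (\<lambda>x. (Y n x)\<^sup>2)" for n
        unfolding Y_def using intX[of "Suc n" "\<lambda>k. (\<xi> k)\<^sup>2"] by simp
      show "distr M borel (Y n) = distr (measure_pmf law) borel \<xi>" for n
        unfolding Y_def law[of "Suc n", simplified, symmetric] by (subst distr_distr) (auto simp: o_def)
    qed (rule \<sigma>)
    moreover have "(\<lambda>w. (\<Sum>i<n. Y i w) / sqrt (real n * \<sigma>\<^sup>2)) \<in> borel_measurable M" for n
      unfolding Y_def by (auto intro!: borel_measurable_sum borel_measurable_divide)
    moreover have "continuous_on UNIV (\<lambda>x. \<phi> (\<sigma> * x))"
      by (intro continuous_on_compose2[OF \<phi>(1)] continuous_intros) auto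
    then have "isCont (\<lambda>x. \<phi> (\<sigma> * x)) x" for x
      by (simp add: continuous_on_eq_continuous_at)
    ultimately have "(\<lambda>n. \<integral>x. \<phi> (\<sigma> * x) \<partial>distr M borel (\<lambda>w. (\<Sum>i<n. Y i w) / sqrt (real n * \<sigma>\<^sup>2)))
        \<longlonglongrightarrow> (\<integral>x. \<phi> (\<sigma> * x) \<partial>std_normal_distribution)"
      using \<phi>(2)
      by (intro weak_conv_imp_integral_bdd_continuous_conv[where B = B] real_distribution_distr real_dist_normal_dist)
         auto
    moreover have "(\<integral>x. \<phi> (\<sigma> * x) \<partial>distr M borel (\<lambda>w. (\<Sum>i<n. Y i w) / sqrt (real n * \<sigma>\<^sup>2)))
        = (\<integral>w. \<phi> ((\<Sum>i=1..n. \<xi> (X i w)) / sqrt (real n)) \<partial>M)" for n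
    proof -
      have "(\<Sum>i<n. Y i w) = (\<Sum>i=1..n. \<xi> (X i w))" for w
        unfolding Y_def by (rule sum.reindex_bij_witness[of _ "\<lambda>i. i - 1" Suc]) auto
      moreover have "(\<lambda>w. (\<Sum>i<n. Y i w) / sqrt (real n * \<sigma>\<^sup>2)) \<in> borel_measurable M"
        by fact
      ultimately show ?thesis
        using \<sigma>(1) by (subst integral_distr) (auto simp: real_sqrt_mult)
    qed
    moreover have "(\<integral>x. \<phi> (\<sigma> * x) \<partial>std_normal_distribution) = (\<integral>y. \<phi> y \<partial>normal_law 0 v)"
      unfolding \<sigma>(2)[symmetric] distr_std_normal_scale[OF \<sigma>(1), symmetric]
      by (subst integral_distr) auto
    ultimately show ?thesis by (simp add: v_def)
  qed
qed

text \<open>The limit law is built from the vectors \<open>sqrt (pmf law k) *\<^sub>R \<zeta> k\<close>, whose outer products sum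
  to the covariance of \<open>\<zeta>\<close>. The one-dimensional theorem applies to every linear functional, and the
  Cramer--Wold device assembles the results. The target is an arbitrary Euclidean space, so that
  matrix-valued \<open>\<zeta>\<close> are covered as well.\<close>

theorem central_limit_theorem_vector:
  fixes X :: "nat \<Rightarrow> 'w \<Rightarrow> 'k::countable" and \<zeta> :: "'k \<Rightarrow> 'a::euclidean_space"
  assumes P: "prob_space P"
    and indep: "prob_space.indep_vars P (\<lambda>_. count_space UNIV) X {1..}"
    and law: "\<forall>i\<ge>1. distr P (count_space UNIV) (X i) = measure_pmf law"
    and fin: "finite (set_pmf law)"
    and mean: "measure_pmf.expectation law \<zeta> = 0"
  shows "\<exists>N. prob_space N \<and> sets N = sets borel \<and>
    (\<forall>t. distr N borel (\<lambda>x. t \<bullet> x)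
           = normal_law 0 (measure_pmf.expectation law (\<lambda>k. (t \<bullet> \<zeta> k)\<^sup>2))) \<and>
    converges_in_distribution P (\<lambda>n w. (\<Sum>i=1..n. \<zeta> (X i w)) /\<^sub>R sqrt (real n)) N"
proof -
  interpret P: prob_space P by fact
  have X [measurable]: "X i \<in> measurable P (count_space UNIV)" if "i \<ge> 1" for i
    using indep that by (auto simp: P.indep_vars_def)
  have int: "integrable (measure_pmf law) h" for h :: "'k \<Rightarrow> 'a"
    by (rule integrable_measure_pmf_finite[OF fin])
  obtain N where N: "prob_space N" "sets N = sets borel"
    and N_law: "\<And>t. distr N borel (\<lambda>x. t \<bullet> x)
        = normal_law 0 (\<Sum>k\<in>set_pmf law. (t \<bullet> (sqrt (pmf law k) *\<^sub>R \<zeta> k))\<^sup>2)"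
    using gaussian_law_exists[OF fin, of "\<lambda>k. sqrt (pmf law k) *\<^sub>R \<zeta> k"] by metis
  have var: "(\<Sum>k\<in>set_pmf law. (t \<bullet> (sqrt (pmf law k) *\<^sub>R \<zeta> k))\<^sup>2)
      = measure_pmf.expectation law (\<lambda>k. (t \<bullet> \<zeta> k)\<^sup>2)" for t
    by (subst integral_measure_pmf[OF fin]) (auto simp: power_mult_distrib)
  note N_law' = N_law[unfolded var]
  have [measurable_cong]: "sets N = sets borel" by fact
  have "converges_in_distribution P (\<lambda>n w. (\<Sum>i=1..n. \<zeta> (X i w)) /\<^sub>R sqrt (real n)) N"
  proof (rule cramer_wold[OF P _ N])
    show "(\<lambda>w. (\<Sum>i=1..n. \<zeta> (X i w)) /\<^sub>R sqrt (real n)) \<in> borel_measurable P" for n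
      by (intro borel_measurable_scaleR borel_measurable_sum borel_measurable_const) auto
    fix t :: 'a and \<phi> :: "real \<Rightarrow> real" assume \<phi>: "bounded_lipschitz \<phi>"
    have "(\<lambda>n. \<integral>w. \<phi> ((\<Sum>i=1..n. t \<bullet> \<zeta> (X i w)) / sqrt (real n)) \<partial>P)
        \<longlonglongrightarrow> (\<integral>y. \<phi> y \<partial>normal_law 0 (measure_pmf.expectation law (\<lambda>k. (t \<bullet> \<zeta> k)\<^sup>2)))"
      using \<phi> int mean
      by (intro P.central_limit_theorem_bounded_continuous[OF indep law fin, where B = 1]
            bounded_lipschitz_continuous) (auto simp: bounded_lipschitz_def)
    also have "(\<lambda>n. \<integral>w. \<phi> ((\<Sum>i=1..n. t \<bullet> \<zeta> (X i w)) / sqrt (real n)) \<partial>P)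
        = (\<lambda>n. \<integral>w. \<phi> (t \<bullet> ((\<Sum>i=1..n. \<zeta> (X i w)) /\<^sub>R sqrt (real n))) \<partial>P)"
      by (simp add: inner_sum_right divide_inverse mult.commute)
    also have "(\<integral>y. \<phi> y \<partial>normal_law 0 (measure_pmf.expectation law (\<lambda>k. (t \<bullet> \<zeta> k)\<^sup>2)))
        = (\<integral>y. \<phi> (t \<bullet> y) \<partial>N)"
      unfolding N_law'[symmetric]
      by (subst integral_distr) (auto intro: bounded_lipschitz_measurable[OF \<phi>])
    finally show "(\<lambda>n. \<integral>w. \<phi> (t \<bullet> ((\<Sum>i=1..n. \<zeta> (X i w)) /\<^sub>R sqrt (real n))) \<partial>P)
        \<longlonglongrightarrow> (\<integral>y. \<phi> (t \<bullet> y) \<partial>N)" .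
  qed
  with N N_law' show ?thesis by blast
qed

theorem weak_law_of_large_numbers_vector:
  fixes X :: "nat \<Rightarrow> 'w \<Rightarrow> 'k::countable" and \<zeta> :: "'k \<Rightarrow> 'a::euclidean_space"
  assumes P: "prob_space P"
    and indep: "prob_space.indep_vars P (\<lambda>_. count_space UNIV) X {1..}"
    and law: "\<forall>i\<ge>1. distr P (count_space UNIV) (X i) = measure_pmf law"
    and fin: "finite (set_pmf law)"
  shows "converges_in_prob P (\<lambda>n w. (\<Sum>i=1..n. \<zeta> (X i w)) /\<^sub>R real n)
           (measure_pmf.expectation law \<zeta>)"
proof -
  let ?m = "measure_pmf.expectation law \<zeta>"
  have "integrable (measure_pmf law) \<zeta>"
    by (rule integrable_measure_pmf_finite[OF fin])
  then have "measure_pmf.expectation law (\<lambda>k. \<zeta> k - ?m) = 0"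
    by simp
  then obtain N where
    "converges_in_distribution P (\<lambda>n w. (\<Sum>i=1..n. \<zeta> (X i w) - ?m) /\<^sub>R sqrt (real n)) N"
    using central_limit_theorem_vector[OF P indep law fin] by blast
  from converges_in_prob_scaled[OF P this]
  have lim: "(\<lambda>n. measure P {w \<in> space P.
      dist ((\<Sum>i=1..n. \<zeta> (X i w) - ?m) /\<^sub>R sqrt (real n) /\<^sub>R sqrt (real n)) 0 > e}) \<longlonglongrightarrow> 0"
    if "e > 0" for e
    using that by (simp add: converges_in_prob_def)
  have eq: "dist ((\<Sum>i=1..n. \<zeta> (X i w) - ?m) /\<^sub>R sqrt (real n) /\<^sub>R sqrt (real n)) 0
      = dist ((\<Sum>i=1..n. \<zeta> (X i w)) /\<^sub>R real n) ?m" if "n \<ge> 1" for n w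
  proof -
    have "(\<Sum>i=1..n. \<zeta> (X i w) - ?m) /\<^sub>R sqrt (real n) /\<^sub>R sqrt (real n)
        = (\<Sum>i=1..n. \<zeta> (X i w) - ?m) /\<^sub>R real n"
      by (simp flip: inverse_mult_distrib)
    also have "\<dots> = (\<Sum>i=1..n. \<zeta> (X i w)) /\<^sub>R real n - ?m"
      using that by (simp add: sum_subtractf scaleR_diff_right sum_constant_scaleR)
    finally show ?thesis by (simp add: dist_norm)
  qed
  show ?thesis
    unfolding converges_in_prob_def
  proof (intro allI impI)
    fix e :: real assume "e > 0"
    show "(\<lambda>n. measure P {w \<in> space P. e < dist ((\<Sum>i=1..n. \<zeta> (X i w)) /\<^sub>R real n) ?m}) \<longlonglongrightarrow> 0"
      by (rule Lim_transform_eventually[OF lim[OF \<open>e > 0\<close>]])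
         (rule eventually_mono[OF eventually_ge_at_top[of 1]], simp only: eq)
  qed
qed

section \<open>Asymptotic linearity of Z-estimators\<close>

lemma norm_matrix_vector_mult_le:
  fixes A :: "real ^ 'n ^ 'm"
  shows "norm (A *v x) \<le> norm A * norm x"
proof -
  have "norm (A *v x) = L2_set (\<lambda>i. \<bar>A $ i \<bullet> x\<bar>) UNIV"
    by (simp add: norm_vec_def matrix_vector_mult_def inner_vec_def)
  also have "\<dots> \<le> L2_set (\<lambda>i. norm (A $ i) * norm x) UNIV"
    by (intro L2_set_mono Cauchy_Schwarz_ineq2) auto
  also have "\<dots> = norm A * norm x"
    by (simp add: norm_vec_def[of A] L2_set_left_distrib)
  finally show ?thesis .
qed

text \<open>The algebra behind the asymptotic linearity of a root: \<open>d\<close> is the estimation error, \<open>\<rho>\<close> the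
  Taylor remainder of \<open>g\<close> and \<open>r\<close> the rate. Solving the equation for \<open>A *v c\<close> gives
  \<open>d + K *v (A *v c) = - K *v ((A - A0) *v (G *v d) + A *v \<rho>)\<close>, which is at most \<open>\<kappa> * norm d\<close>.
  So the difference between \<open>r *\<^sub>R d\<close> and its linearization \<open>W\<close> is at most a fraction \<open>\<kappa> \<le> 1 / 2\<close> of
  \<open>r *\<^sub>R d\<close> in norm, and can be absorbed to leave a bound by \<open>W\<close> alone. This is why
  consistency alone, without a rate, yields asymptotic linearity.\<close>

lemma linearization_error:
  fixes A A0 :: "real ^ 'r ^ 'q" and G :: "real ^ 'q ^ 'r" and K :: "real ^ 'q ^ 'q"
  assumes K: "K ** (A0 ** G) = mat 1"
    and root: "A *v (c + G *v d + \<rho>) = 0"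
    and A: "norm (A - A0) \<le> \<eta>" "\<eta> \<le> 1" and \<rho>: "norm \<rho> \<le> \<eta> * norm d"
    and small: "norm K * (norm G + norm A0 + 1) * \<eta> \<le> \<kappa>" "\<kappa> \<le> 1 / 2" and r: "r \<ge> 0"
  shows "norm (r *\<^sub>R d - - (K *v (r *\<^sub>R (A *v c)))) \<le> 2 * \<kappa> * norm (- (K *v (r *\<^sub>R (A *v c))))"
proof -
  have \<eta>: "\<eta> \<ge> 0" using A(1) norm_ge_zero order_trans by blast
  have "A *v c + (A *v (G *v d) + A *v \<rho>) = 0"
    using root by (simp add: matrix_vector_right_distrib add.assoc)
  then have "A *v c = - (A *v (G *v d) + A *v \<rho>)"
    by (rule eq_neg_iff_add_eq_0[THEN iffD2])
  then have "A0 *v (G *v d) + A *v c = - ((A - A0) *v (G *v d) + A *v \<rho>)"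
    by (simp add: matrix_vector_mult_diff_rdistrib)
  moreover have "d = K *v (A0 *v (G *v d))"
    using K by (metis matrix_vector_mul_assoc matrix_vector_mul_lid)
  ultimately have eq: "d + K *v (A *v c) = - (K *v ((A - A0) *v (G *v d) + A *v \<rho>))"
    by (metis matrix_vector_right_distrib linear_neg matrix_vector_mul_linear)
  have "norm A \<le> norm A0 + 1"
    using A norm_triangle_ineq2[of A A0] by linarith
  then have "norm ((A - A0) *v (G *v d) + A *v \<rho>) \<le> \<eta> * (norm G * norm d) + (norm A0 + 1) * (\<eta> * norm d)"
    using A \<rho> \<eta>
    by (intro norm_triangle_le add_mono order_trans[OF norm_matrix_vector_mult_le] mult_mono
          norm_matrix_vector_mult_le) auto
  then have "norm (d + K *v (A *v c)) \<le> norm K * (\<eta> * (norm G * norm d) + (norm A0 + 1) * (\<eta> * norm d))"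
    unfolding eq norm_minus_cancel
    by (intro order_trans[OF norm_matrix_vector_mult_le] mult_left_mono) auto
  also have "\<dots> = norm K * (norm G + norm A0 + 1) * \<eta> * norm d"
    by (simp add: algebra_simps)
  also have "\<dots> \<le> \<kappa> * norm d"
    using small by (intro mult_right_mono) auto
  finally have le: "norm (d + K *v (A *v c)) \<le> \<kappa> * norm d" .
  define W where "W = - (K *v (r *\<^sub>R (A *v c)))"
  have "r *\<^sub>R d - W = r *\<^sub>R (d + K *v (A *v c))"
    by (simp add: W_def matrix_vector_mult_scaleR scaleR_add_right)
  then have "norm (r *\<^sub>R d - W) = r * norm (d + K *v (A *v c))"
    using r by simp
  also have "\<dots> \<le> r * (\<kappa> * norm d)"
    by (rule mult_left_mono[OF le r])
  also have "\<dots> = \<kappa> * norm (r *\<^sub>R d)"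
    using r by simp
  finally have "norm (r *\<^sub>R d - W) \<le> \<kappa> * norm (r *\<^sub>R d)" .
  moreover have "norm (r *\<^sub>R d) \<le> norm (r *\<^sub>R d - W) + norm W"
    using norm_triangle_sub[of "r *\<^sub>R d" W] by simp
  moreover have "\<kappa> \<ge> 0"
    by (rule order_trans[OF _ small(1)]) (use \<eta> in simp)
  ultimately have "norm (r *\<^sub>R d - W) \<le> \<kappa> * (norm (r *\<^sub>R d - W) + norm W)"
    using mult_left_mono order_trans by blast
  moreover have "\<kappa> * norm (r *\<^sub>R d - W) \<le> 1 / 2 * norm (r *\<^sub>R d - W)"
    using small(2) by (intro mult_right_mono) auto
  ultimately show ?thesis
    unfolding W_def[symmetric] by (simp add: ring_distribs)
qed

text \<open>With probability tending to one, the equation holds, \<open>A n\<close> is close to its limit and the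
  estimator is close enough to \<open>\<theta>s\<close> for the Taylor remainder to be small. There the error of the
  linearization is at most \<open>2 * \<kappa>\<close> times the norm of the linearization, which is tight, and \<open>\<kappa>\<close> is
  arbitrary. The events \<open>C n\<close> collect the samples on which the equation may fail.\<close>

lemma z_estimator_asymptotically_linear:
  fixes A :: "nat \<Rightarrow> 'w \<Rightarrow> real ^ 'r ^ 'q" and A0 :: "real ^ 'r ^ 'q"
    and G :: "real ^ 'q ^ 'r" and K :: "real ^ 'q ^ 'q"
  assumes P: "prob_space P"
    and g: "(g has_derivative (\<lambda>d. G *v d)) (at \<theta>s)"
    and K: "K ** (A0 ** G) = mat 1"
    and A [measurable]: "\<And>n. A n \<in> borel_measurable P" and A_lim: "converges_in_prob P A A0"
    and est [measurable]: "\<And>n. est n \<in> borel_measurable P" and est_lim: "converges_in_prob P est \<theta>s"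
    and C_sets: "eventually (\<lambda>n. C n \<in> sets P) sequentially"
    and C_lim: "(\<lambda>n. measure P (C n)) \<longlonglongrightarrow> 0"
    and root: "\<And>n. AE w in P. w \<notin> C n \<longrightarrow> A n w *v g (est n w) = 0"
    and W: "converges_in_distribution P (\<lambda>n w. - (K *v (sqrt (real n) *\<^sub>R (A n w *v g \<theta>s)))) N"
  shows "converges_in_prob P (\<lambda>n w. sqrt (real n) *\<^sub>R (est n w - \<theta>s)
           - - (K *v (sqrt (real n) *\<^sub>R (A n w *v g \<theta>s)))) 0"
proof -
  interpret P: prob_space P by fact
  define W where "W n w = - (K *v (sqrt (real n) *\<^sub>R (A n w *v g \<theta>s)))" for n w
  have W_meas [measurable]: "W n \<in> borel_measurable P" for n
    using W by (simp add: converges_in_distribution_def W_def[abs_def])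
  have "(\<lambda>n. measure P {w \<in> space P. dist (sqrt (real n) *\<^sub>R (est n w - \<theta>s) - W n w) 0 > e}) \<longlonglongrightarrow> 0"
    if e: "e > 0" for e
  proof (rule tendstoI)
    fix \<epsilon> :: real assume \<epsilon>: "\<epsilon> > 0"
    then obtain L where L: "L > 0"
      and W_tail: "eventually (\<lambda>n. measure P {w \<in> space P. norm (W n w) > L} < \<epsilon> / 4) sequentially"
      unfolding W_def using converges_in_distribution_tight[OF P W, of "\<epsilon> / 4"] by auto
    \<comment> \<open>\<open>\<kappa>\<close> makes the error \<open>2 * \<kappa> * L\<close> at most \<open>e\<close>; \<open>\<eta>\<close> is the accuracy in \<open>A n\<close> and in the Taylor
        expansion that yields this \<open>\<kappa>\<close>. The \<open>+ 1\<close> only keeps the denominator positive.\<close>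
    define \<kappa> where "\<kappa> = min (1 / 2) (e / (2 * L))"
    define \<eta> where "\<eta> = min 1 (\<kappa> / (norm K * (norm G + norm A0 + 1) + 1))"
    have \<kappa>: "\<kappa> > 0" "\<kappa> \<le> 1 / 2" "2 * \<kappa> * L \<le> e"
      using e L by (auto simp: \<kappa>_def min_def field_simps)
    have den: "norm K * (norm G + norm A0 + 1) \<ge> 0" by simp
    have \<eta>: "\<eta> > 0" "\<eta> \<le> 1"
      using \<kappa> den by (auto simp: \<eta>_def intro!: divide_pos_pos add_nonneg_pos)
    have \<eta>\<kappa>: "norm K * (norm G + norm A0 + 1) * \<eta> \<le> \<kappa>"
    proof -
      let ?D = "norm K * (norm G + norm A0 + 1)"
      have "?D * \<eta> \<le> (?D + 1) * (\<kappa> / (?D + 1))"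
        using den \<eta> \<kappa> by (intro mult_mono) (auto simp: \<eta>_def)
      also have "\<dots> = \<kappa>"
        using den add_nonneg_pos[OF den, of 1] by (simp del: norm_ge_zero)
      finally show ?thesis .
    qed
    obtain \<delta> where \<delta>: "\<delta> > 0"
      and taylor: "\<And>y. norm (y - \<theta>s) < \<delta> \<Longrightarrow> norm (g y - g \<theta>s - G *v (y - \<theta>s)) \<le> \<eta> * norm (y - \<theta>s)"
      using g \<eta>(1) unfolding has_derivative_at_alt by blast
    define B1 where "B1 n = {w \<in> space P. norm (W n w) > L}" for n
    define B2 where "B2 n = {w \<in> space P. dist (A n w) A0 > \<eta>}" for n
    define B3 where "B3 n = {w \<in> space P. dist (est n w) \<theta>s > \<delta> / 2}" for n
    have [measurable]: "B1 n \<in> sets P" "B2 n \<in> sets P" "B3 n \<in> sets P" for n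
      unfolding B1_def B2_def B3_def by measurable
    have B2: "(\<lambda>n. measure P (B2 n)) \<longlonglongrightarrow> 0"
      unfolding B2_def by (rule A_lim[unfolded converges_in_prob_def, rule_format, OF \<eta>(1)])
    have B3: "(\<lambda>n. measure P (B3 n)) \<longlonglongrightarrow> 0"
      unfolding B3_def
      by (rule est_lim[unfolded converges_in_prob_def, rule_format]) (use \<delta> in simp)
    have quarter: "0 < \<epsilon> / 4" using \<epsilon> by simp
    from W_tail[folded B1_def] order_tendstoD(2)[OF B2 quarter] order_tendstoD(2)[OF B3 quarter]
      order_tendstoD(2)[OF C_lim quarter] C_sets
    show "eventually (\<lambda>n. dist (measure P {w \<in> space P.
        dist (sqrt (real n) *\<^sub>R (est n w - \<theta>s) - W n w) 0 > e}) 0 < \<epsilon>) sequentially"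
    proof eventually_elim
      case (elim n)
      note [measurable] = elim(5)
      have "AE w in P. dist (sqrt (real n) *\<^sub>R (est n w - \<theta>s) - W n w) 0 > e
          \<longrightarrow> w \<in> B1 n \<union> B2 n \<union> B3 n \<union> C n"
        using root[of n] AE_space
      proof eventually_elim
        case (elim w)
        show ?case
        proof (rule impI, rule ccontr)
          assume gt: "dist (sqrt (real n) *\<^sub>R (est n w - \<theta>s) - W n w) 0 > e"
            and "w \<notin> B1 n \<union> B2 n \<union> B3 n \<union> C n"
          then have good: "norm (W n w) \<le> L" "norm (A n w - A0) \<le> \<eta>" "norm (est n w - \<theta>s) < \<delta>"
              "A n w *v g (est n w) = 0"
            using elim \<delta> by (auto simp: B1_def B2_def B3_def dist_norm)
          define d where "d = est n w - \<theta>s"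
          define \<rho> where "\<rho> = g (est n w) - g \<theta>s - G *v d"
          have "norm (sqrt (real n) *\<^sub>R d - W n w) \<le> 2 * \<kappa> * norm (W n w)"
            unfolding W_def
          proof (rule linearization_error[OF K])
            show "A n w *v (g \<theta>s + G *v d + \<rho>) = 0"
              using good(4) by (simp add: \<rho>_def)
            show "norm \<rho> \<le> \<eta> * norm d"
              using taylor[OF good(3)] by (simp add: \<rho>_def d_def)
          qed (use good \<eta> \<eta>\<kappa> \<kappa> in auto)
          also have "\<dots> \<le> 2 * \<kappa> * L"
            using good(1) \<kappa> by (intro mult_left_mono) auto
          finally show False using gt \<kappa>(3) by (simp add: d_def)
        qed
      qed
      then have "measure P {w \<in> space P. dist (sqrt (real n) *\<^sub>R (est n w - \<theta>s) - W n w) 0 > e}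
          \<le> measure P (B1 n \<union> B2 n \<union> B3 n \<union> C n)"
        by (intro P.finite_measure_mono_AE) (auto elim!: eventually_mono)
      also have "\<dots> \<le> measure P (B1 n) + measure P (B2 n) + measure P (B3 n) + measure P (C n)"
        by (intro order_trans[OF measure_Un_le] add_mono) auto
      finally show ?case using elim(1-4) by simp
    qed
  qed
  then show ?thesis by (simp add: converges_in_prob_def W_def)
qed

section \<open>Asymptotic normality of the Stein estimator\<close>

theorem theorem4p4:
  fixes \<Theta> :: "(real ^ 'q) set"
    and I :: "int set"
    and p \<tau> :: "real ^ 'q \<Rightarrow> int \<Rightarrow> real"
    and \<theta>s :: "real ^ 'q"
    and as bs :: int
    and f :: "int \<Rightarrow> int \<Rightarrow> int \<Rightarrow> real ^ 'q"
    and M :: "int \<Rightarrow> int \<Rightarrow> int \<Rightarrow> real ^ 'r ^ 'q"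
    and g :: "real ^ 'q \<Rightarrow> real ^ 'r"
    and P :: "'w measure"
    and X :: "nat \<Rightarrow> 'w \<Rightarrow> int"
    and est :: "nat \<Rightarrow> 'w \<Rightarrow> real ^ 'q"
    and law :: "int pmf"
    and D V \<Sigma> :: "real ^ 'q ^ 'q"
  defines "law \<equiv> truncated_pmf (p \<theta>s) as bs"
    and "D \<equiv> measure_pmf.expectation law
               (\<lambda>k. jacobian (\<lambda>\<theta>. stein_op_vec (p \<theta>) (\<tau> \<theta>) (f as bs) k) (at \<theta>s))"
    and "V \<equiv> measure_pmf.expectation law
               (\<lambda>k. outer_product (stein_op_vec (p \<theta>s) (\<tau> \<theta>s) (f as bs) k)
                                  (stein_op_vec (p \<theta>s) (\<tau> \<theta>s) (f as bs) k))"
    and "\<Sigma> \<equiv> matrix_inv D ** V ** transpose (matrix_inv D)"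
  \<comment> \<open>setting\<close>
  assumes "open \<Theta>"
    and "\<forall>i\<in>I. \<forall>j\<in>I. {i..j} \<subseteq> I"
    and "\<forall>\<theta>\<in>\<Theta>. \<forall>k\<in>I. p \<theta> k > 0"
    and "\<theta>s \<in> \<Theta>" and "as < bs" and "{as..bs} \<subseteq> I"
    and "\<forall>a b. as \<le> a \<and> a \<le> b \<and> b \<le> bs \<longrightarrow> (\<forall>j. (\<lambda>k. f a b k $ j) \<in> test_class a b)"
  \<comment> \<open>the i.i.d. sample\<close>
    and "prob_space P"
    and "prob_space.indep_vars P (\<lambda>_. count_space UNIV) X {1..}"
    and "\<forall>i\<ge>1. distr P (count_space UNIV) (X i) = measure_pmf law"
  \<comment> \<open>condition (a)\<close>
    and "\<forall>\<theta>\<in>\<Theta>. measure_pmf.expectation law (\<lambda>k. stein_op_vec (p \<theta>) (\<tau> \<theta>) (f as bs) k) = 0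
                 \<longleftrightarrow> \<theta> = \<theta>s"
    and "\<forall>a b. as \<le> a \<and> a \<le> b \<and> b \<le> bs \<longrightarrow>
           integrable (measure_pmf law) (\<lambda>k. (norm (M a b k))\<^sup>2)"
  \<comment> \<open>condition (b)\<close>
    and "CARD('q) \<le> CARD('r)"
    and "\<forall>a b. as \<le> a \<and> a \<le> b \<and> b \<le> bs \<longrightarrow> M a b \<in> borel_measurable (count_space UNIV)"
    and "continuously_differentiable_on g \<Theta>"
    and "\<forall>a b. as \<le> a \<and> a \<le> b \<and> b \<le> bs \<longrightarrow>
           (\<forall>\<theta>\<in>\<Theta>. \<forall>k\<in>{a..b}. stein_op_vec (p \<theta>) (\<tau> \<theta>) (f a b) k = M a b k *v g \<theta>)"
    and "invertible (measure_pmf.expectation law (M as bs) ** jacobian g (at \<theta>s))"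
  \<comment> \<open>condition (c)\<close>
    and "\<exists>C>0. \<forall>\<theta>'\<in>\<Theta>. \<forall>k\<in>{as..bs}. \<forall>a b. as \<le> a \<and> a \<le> b \<and> b \<le> bs \<longrightarrow>
           (\<forall>j l. let F = (\<lambda>\<theta>. stein_op_vec (p \<theta>) (\<tau> \<theta>) (f a b) k) in
              partially_differentiable l F \<theta>' \<and>
              partially_differentiable j (partial_deriv l F) \<theta>' \<and>
              norm (partial_deriv j (partial_deriv l F) \<theta>') \<le> C)"
  \<comment> \<open>the consistent sequence of Stein estimators\<close>
    and "\<forall>n. est n \<in> borel_measurable P"
    and "\<forall>n. \<forall>w\<in>space P. est n w \<in> \<Theta>"
    and "(\<lambda>n. measure P {w \<in> space P. solves_stein_eqs p \<tau> f X n w (est n w)}) \<longlonglongrightarrow> 1"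
    and "converges_in_prob P est \<theta>s"
  shows "\<exists>N. is_multivariate_normal N 0 \<Sigma> \<and>
             converges_in_distribution P (\<lambda>n w. sqrt (real n) *\<^sub>R (est n w - \<theta>s)) N"
proof -
  have ab: "as \<le> bs" using \<open>as < bs\<close> by simp
  have ppos: "p \<theta>s k > 0" if "k \<in> {as..bs}" for k
    using that \<open>{as..bs} \<subseteq> I\<close> \<open>\<theta>s \<in> \<Theta>\<close> \<open>\<forall>\<theta>\<in>\<Theta>. \<forall>k\<in>I. p \<theta> k > 0\<close> by blast
  have pmf: "pmf law k = (if k \<in> {as..bs} then p \<theta>s k / (\<Sum>i = as..bs. p \<theta>s i) else 0)" for k
    unfolding law_def using ab ppos by (rule pmf_truncated_pmf)
  have Z: "(\<Sum>i = as..bs. p \<theta>s i) > 0"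
    using ab ppos by (intro sum_pos) auto
  have supp: "set_pmf law = {as..bs}"
    using ppos Z by (auto simp: set_pmf_eq pmf split: if_splits) (metis atLeastAtMost_iff less_irrefl)+
  have fin: "finite (set_pmf law)" unfolding supp by simp
  have E: "measure_pmf.expectation law h = (\<Sum>k=as..bs. pmf law k *\<^sub>R h k)"
    for h :: "int \<Rightarrow> 'c::euclidean_space"
    by (rule integral_measure_pmf) (auto simp: supp)

  interpret P: prob_space P by fact
  note indep = \<open>P.indep_vars (\<lambda>_. count_space UNIV) X {1..}\<close>
  note law = \<open>\<forall>i\<ge>1. distr P (count_space UNIV) (X i) = measure_pmf law\<close>
  have X [measurable]: "X i \<in> measurable P (count_space UNIV)" if "i \<ge> 1" for i
    using indep that by (auto simp: P.indep_vars_def)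
  have est [measurable]: "est n \<in> borel_measurable P" for n
    using \<open>\<forall>n. est n \<in> borel_measurable P\<close> by blast

  define m where "m = M as bs"
  define G where "G = jacobian g (at \<theta>s)"
  define m0 where "m0 = measure_pmf.expectation law m"
  define K where "K = matrix_inv D"
  define a where "a k = stein_op_vec (p \<theta>s) (\<tau> \<theta>s) (f as bs) k" for k
  have stein: "stein_op_vec (p \<theta>) (\<tau> \<theta>) (f as bs) k = m k *v g \<theta>" if "\<theta> \<in> \<Theta>" "k \<in> {as..bs}" for \<theta> k
    using that ab \<open>\<forall>a b. as \<le> a \<and> a \<le> b \<and> b \<le> bs \<longrightarrow>
           (\<forall>\<theta>\<in>\<Theta>. \<forall>k\<in>{a..b}. stein_op_vec (p \<theta>) (\<tau> \<theta>) (f a b) k = M a b k *v g \<theta>)\<close>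
    by (auto simp: m_def)
  have g: "(g has_derivative (\<lambda>d. G *v d)) (at \<theta>s)"
    using \<open>continuously_differentiable_on g \<Theta>\<close> \<open>\<theta>s \<in> \<Theta>\<close>
    by (auto simp: continuously_differentiable_on_def G_def jacobian_works)

  \<comment> \<open>Near \<open>\<theta>s\<close> the Stein operator is the linear image \<open>m k *v g \<theta>\<close>, so the chain rule applies.\<close>
  have jac: "jacobian (\<lambda>\<theta>. stein_op_vec (p \<theta>) (\<tau> \<theta>) (f as bs) k) (at \<theta>s) = m k ** G"
    if k: "k \<in> {as..bs}" for k
  proof -
    have "((\<lambda>\<theta>. m k *v g \<theta>) has_derivative (\<lambda>d. m k *v (G *v d))) (at \<theta>s)"
      by (rule bounded_linear.has_derivative[OF matrix_vector_mul_bounded_linear g])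
    then have "((\<lambda>\<theta>. stein_op_vec (p \<theta>) (\<tau> \<theta>) (f as bs) k) has_derivative (\<lambda>d. (m k ** G) *v d)) (at \<theta>s)"
      unfolding matrix_vector_mul_assoc
      by (rule has_derivative_transform_within_open[OF _ \<open>open \<Theta>\<close> \<open>\<theta>s \<in> \<Theta>\<close>]) (rule stein[symmetric, OF _ k])
    from frechet_derivative_at[OF this, symmetric] show ?thesis
      by (simp add: jacobian_def)
  qed
  have D: "D = m0 ** G"
  proof -
    have "D = (\<Sum>k=as..bs. pmf law k *\<^sub>R (m k ** G))"
      unfolding D_def E by (intro sum.cong refl) (simp add: jac)
    also have "\<dots> = (\<Sum>k=as..bs. pmf law k *\<^sub>R m k) ** G"
      by (simp add: vec_eq_iff matrix_matrix_mult_def sum_distrib_left sum_distrib_right mult.assoc)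
         (subst sum.swap, simp)
    finally show ?thesis by (simp add: m0_def E)
  qed
  have "invertible D"
    using \<open>invertible (measure_pmf.expectation law (M as bs) ** jacobian g (at \<theta>s))\<close>
    by (simp add: D m0_def m_def G_def)
  then have K: "K ** (m0 ** G) = mat 1"
    unfolding D[symmetric] K_def matrix_inv_def invertible_def by (rule someI2_ex) auto

  \<comment> \<open>\<open>\<zeta>\<close> is the influence function: the estimator will be asymptotically the sum of its values.\<close>
  define \<zeta> where "\<zeta> k = - (K *v (m k *v g \<theta>s))" for k
  have \<zeta>: "\<zeta> k = - (K *v a k)" if "k \<in> {as..bs}" for k
    using that \<open>\<theta>s \<in> \<Theta>\<close> by (simp add: \<zeta>_def a_def stein)
  have mean: "measure_pmf.expectation law \<zeta> = 0"
  proof -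
    have "measure_pmf.expectation law \<zeta> = (\<Sum>k=as..bs. - (K *v (pmf law k *\<^sub>R a k)))"
      unfolding E by (intro sum.cong refl) (simp add: \<zeta> matrix_vector_mult_scaleR)
    also have "\<dots> = - (K *v measure_pmf.expectation law a)"
      by (simp add: E sum_negf linear_sum[OF matrix_vector_mul_linear])
    also have "measure_pmf.expectation law a = 0"
      using \<open>\<forall>\<theta>\<in>\<Theta>. measure_pmf.expectation law (\<lambda>k. stein_op_vec (p \<theta>) (\<tau> \<theta>) (f as bs) k) = 0
                 \<longleftrightarrow> \<theta> = \<theta>s\<close> \<open>\<theta>s \<in> \<Theta>\<close>
      by (simp add: a_def[abs_def])
    finally show ?thesis by simp
  qed
  have var: "measure_pmf.expectation law (\<lambda>k. (t \<bullet> \<zeta> k)\<^sup>2) = t \<bullet> (\<Sigma> *v t)" for t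
  proof -
    define s where "s = transpose K *v t"
    have outer: "outer_product u u *v s = (u \<bullet> s) *\<^sub>R u" for u :: "real ^ 'q"
      by (simp add: vec_eq_iff outer_product_def matrix_vector_mult_def inner_vec_def
            sum_distrib_left sum_distrib_right mult_ac)
    have s: "s \<bullet> u = t \<bullet> (K *v u)" for u
      by (simp add: s_def dot_lmul_matrix)
    have V: "V *v s = (\<Sum>k=as..bs. pmf law k *\<^sub>R ((a k \<bullet> s) *\<^sub>R a k))"
    proof -
      have "V *v s = (\<Sum>k=as..bs. pmf law k *\<^sub>R outer_product (a k) (a k)) *v s"
        unfolding V_def E a_def ..
      also have "\<dots> = (\<Sum>k=as..bs. pmf law k *\<^sub>R (outer_product (a k) (a k) *v s))"
        by (simp add: vec_eq_iff matrix_vector_mult_def sum_distrib_left sum_distrib_right mult.assoc)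
           (subst sum.swap, simp)
      finally show ?thesis by (simp add: outer)
    qed
    have "\<Sigma> *v t = K *v (V *v s)"
      by (simp only: \<Sigma>_def K_def[symmetric] s_def matrix_vector_mul_assoc matrix_mul_assoc)
    then have "t \<bullet> (\<Sigma> *v t) = s \<bullet> (V *v s)"
      by (simp only: s)
    also have "\<dots> = (\<Sum>k=as..bs. pmf law k *\<^sub>R (s \<bullet> a k)\<^sup>2)"
      unfolding V by (simp add: inner_sum_right inner_commute power2_eq_square mult.assoc)
    also have "\<dots> = (\<Sum>k=as..bs. pmf law k *\<^sub>R (t \<bullet> \<zeta> k)\<^sup>2)"
      by (intro sum.cong refl) (simp add: s \<zeta>)
    finally show ?thesis by (simp add: E)
  qed
  obtain N where N: "prob_space N" "sets N = sets borel"
    and N_law: "\<And>t. distr N borel (\<lambda>x. t \<bullet> x)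
               = normal_law 0 (measure_pmf.expectation law (\<lambda>k. (t \<bullet> \<zeta> k)\<^sup>2))"
    and clt: "converges_in_distribution P (\<lambda>n w. (\<Sum>i=1..n. \<zeta> (X i w)) /\<^sub>R sqrt (real n)) N"
    using central_limit_theorem_vector[OF P.prob_space_axioms indep law fin mean] by blast
  have normal: "is_multivariate_normal N 0 \<Sigma>"
    unfolding is_multivariate_normal_def
  proof (intro conjI allI N)
    have "transpose V = V"
      unfolding V_def E
      by (simp add: vec_eq_iff transpose_def outer_product_def mult.commute)
    then show "transpose \<Sigma> = \<Sigma>"
      by (simp add: \<Sigma>_def matrix_transpose_mul matrix_mul_assoc)
    fix t :: "real ^ 'q"
    show "t \<bullet> (\<Sigma> *v t) \<ge> 0"
      unfolding var[symmetric] by simp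
    show "distr N borel (\<lambda>x. t \<bullet> x) = normal_law (t \<bullet> 0) (t \<bullet> (\<Sigma> *v t))"
      by (simp add: N_law var)
  qed

  \<comment> \<open>The estimating equation is \<open>A n w *v g \<theta> = 0\<close> as soon as both truncation points are observed.\<close>
  define A where "A n w = (\<Sum>i=1..n. m (X i w)) /\<^sub>R real n" for n w
  have A_meas: "A n \<in> borel_measurable P" for n
    unfolding A_def[abs_def] by (intro borel_measurable_scaleR borel_measurable_sum borel_measurable_const) auto
  have A_lim: "converges_in_prob P A m0"
    unfolding A_def[abs_def] m0_def
    by (rule weak_law_of_large_numbers_vector[OF P.prob_space_axioms indep law fin])
  have A_mult: "A n w *v x = (\<Sum>i=1..n. m (X i w) *v x) /\<^sub>R real n" for n w x
    by (simp add: A_def vec_eq_iff matrix_vector_mult_def sum_distrib_left sum_distrib_right mult.assoc)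
       (subst sum.swap, simp)
  have W: "- (K *v (sqrt (real n) *\<^sub>R (A n w *v g \<theta>s))) = (\<Sum>i=1..n. \<zeta> (X i w)) /\<^sub>R sqrt (real n)" for n w
  proof -
    have "sqrt (real n) * inverse (real n) = inverse (sqrt (real n))"
      by (metis divide_inverse inverse_eq_divide real_div_sqrt inverse_divide of_nat_0_le_iff)
    then have "sqrt (real n) *\<^sub>R (A n w *v g \<theta>s) = (\<Sum>i=1..n. m (X i w) *v g \<theta>s) /\<^sub>R sqrt (real n)"
      by (simp add: A_mult)
    then show ?thesis
      by (simp add: \<zeta>_def sum_negf matrix_vector_mult_scaleR linear_sum[OF matrix_vector_mul_linear])
  qed

  \<comment> \<open>The truncation points have positive mass, so by the law of large numbers their empirical
      frequencies are positive with probability tending to one: each is then an observed value.\<close>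
  define freq :: "int \<Rightarrow> nat \<Rightarrow> _ \<Rightarrow> real"
    where "freq k n w = (\<Sum>i=1..n. indicator {k} (X i w)) /\<^sub>R real n"
    for k :: int and n w
  have freq_meas [measurable]: "freq k n \<in> borel_measurable P" for k n
    unfolding freq_def[abs_def] by (intro borel_measurable_scaleR borel_measurable_sum borel_measurable_const)
       (auto intro!: measurable_compose[OF X])
  define B where "B k n = {w \<in> space P. dist (freq k n w) (pmf law k) > pmf law k / 2}" for k n
  have B_sets [measurable]: "B k n \<in> sets P" for k n
    unfolding B_def by measurable
  have B_lim: "(\<lambda>n. measure P (B k n)) \<longlonglongrightarrow> 0" if "k \<in> {as..bs}" for k
  proof -
    have "converges_in_prob P (freq k) (measure_pmf.expectation law (indicator {k}))"
      unfolding freq_def[abs_def]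
      by (rule weak_law_of_large_numbers_vector[OF P.prob_space_axioms indep law fin])
    moreover have "measure_pmf.expectation law (indicator {k}) = pmf law k"
      by (simp add: measure_pmf_single)
    moreover have "pmf law k > 0"
      using that by (simp add: pmf_positive_iff supp)
    ultimately have "converges_in_prob P (freq k) (pmf law k)" and "pmf law k / 2 > 0"
      by simp_all
    then show ?thesis
      unfolding converges_in_prob_def B_def by blast
  qed
  have B_hit: "\<exists>i\<in>{1..n}. X i w = k" if "w \<in> space P" "w \<notin> B k n" "k \<in> {as..bs}" for w n k
  proof (rule ccontr)
    assume "\<not> ?thesis"
    then have "freq k n w = 0"
      by (auto simp: freq_def intro!: sum.neutral)
    moreover have "pmf law k > 0"
      using that by (simp add: pmf_positive_iff supp)
    ultimately show False
      using that by (simp add: B_def)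
  qed
  have range: "AE w in P. \<forall>i. i \<ge> 1 \<longrightarrow> X i w \<in> {as..bs}"
  proof -
    have "AE w in P. X i w \<in> {as..bs}" if "i \<ge> 1" for i
    proof (rule AE_distrD[OF X[OF that]])
      show "AE k in distr P (count_space UNIV) (X i). k \<in> {as..bs}"
        unfolding law[rule_format, OF that] by (simp add: AE_measure_pmf_iff supp)
    qed
    then show ?thesis
      by (subst AE_all_countable) (auto intro: AE_impI)
  qed

  \<comment> \<open>Convergence of its probability to \<open>1\<close> forces \<open>S n\<close> to be measurable for large \<open>n\<close>, as a
      nonmeasurable set has measure \<open>0\<close>.\<close>
  define S where "S n = {w \<in> space P. solves_stein_eqs p \<tau> f X n w (est n w)}" for n
  define C where "C n = (space P - S n) \<union> (B as n \<union> B bs n)" for n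
  have S_lim: "(\<lambda>n. measure P (S n)) \<longlonglongrightarrow> 1"
    unfolding S_def by fact
  have S_sets: "eventually (\<lambda>n. S n \<in> sets P) sequentially"
    using order_tendstoD(1)[OF S_lim, of 0]
    by (auto elim!: eventually_mono) (metis less_irrefl measure_notin_sets)
  have C_sets: "eventually (\<lambda>n. C n \<in> sets P) sequentially"
    using S_sets by eventually_elim (auto simp: C_def)
  have C_lim: "(\<lambda>n. measure P (C n)) \<longlonglongrightarrow> 0"
  proof (rule tendsto_sandwich[where f = "\<lambda>_. 0"])
    show "eventually (\<lambda>n. measure P (C n) \<le> (1 - measure P (S n)) + (measure P (B as n) + measure P (B bs n)))
        sequentially"
      using S_sets
    proof eventually_elim
      case (elim n)
      show ?case
        unfolding C_def P.prob_compl[OF elim, symmetric] using elim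
        by (intro order_trans[OF measure_Un_le] add_mono measure_Un_le) auto
    qed
    have "(\<lambda>n. (1 - measure P (S n)) + (measure P (B as n) + measure P (B bs n))) \<longlonglongrightarrow> (1 - 1) + (0 + 0)"
      using ab by (intro tendsto_intros S_lim B_lim) auto
    then show "(\<lambda>n. (1 - measure P (S n)) + (measure P (B as n) + measure P (B bs n))) \<longlonglongrightarrow> 0"
      by simp
  qed auto
  have root: "AE w in P. w \<notin> C n \<longrightarrow> A n w *v g (est n w) = 0" for n
    using range AE_space
  proof eventually_elim
    case (elim w)
    show ?case
    proof
      assume "w \<notin> C n"
      then have sol: "solves_stein_eqs p \<tau> f X n w (est n w)" and hit: "w \<notin> B as n" "w \<notin> B bs n"
        using elim by (auto simp: C_def S_def)
      have "min_est X n w = as"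
        unfolding min_est_def using B_hit[OF elim(2) hit(1)] elim(1) ab
        by (intro Min_eqI) (auto simp: image_iff)
      moreover have "max_est X n w = bs"
        unfolding max_est_def using B_hit[OF elim(2) hit(2)] elim(1) ab
        by (intro Max_eqI) (auto simp: image_iff)
      ultimately have eqs: "(1 / real n) *
          (\<Sum>i = 1..n. stein_op (p (est n w)) (\<tau> (est n w)) (\<lambda>k. f as bs k $ j) (X i w)) = 0" for j
        using sol unfolding solves_stein_eqs_def by metis
      have est_in: "est n w \<in> \<Theta>"
        using \<open>\<forall>n. \<forall>w\<in>space P. est n w \<in> \<Theta>\<close> elim(2) by blast
      have "A n w *v g (est n w)
          = (\<Sum>i=1..n. stein_op_vec (p (est n w)) (\<tau> (est n w)) (f as bs) (X i w)) /\<^sub>R real n"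
        unfolding A_mult using elim(1) est_in by (simp add: stein)
      also have "\<dots> = 0"
        using eqs by (simp add: vec_eq_iff stein_op_vec_def inverse_eq_divide)
      finally show "A n w *v g (est n w) = 0" .
    qed
  qed

  have "converges_in_prob P (\<lambda>n w. sqrt (real n) *\<^sub>R (est n w - \<theta>s)
           - - (K *v (sqrt (real n) *\<^sub>R (A n w *v g \<theta>s)))) 0"
    using \<open>converges_in_prob P est \<theta>s\<close> clt
    by (intro z_estimator_asymptotically_linear[OF P.prob_space_axioms g K A_meas A_lim est _ C_sets C_lim root])
       (simp_all only: W)
  then have "converges_in_prob P (\<lambda>n w. sqrt (real n) *\<^sub>R (est n w - \<theta>s)
           - (\<Sum>i=1..n. \<zeta> (X i w)) /\<^sub>R sqrt (real n)) 0"
    by (simp only: W)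
  then have "converges_in_distribution P (\<lambda>n w. sqrt (real n) *\<^sub>R (est n w - \<theta>s)) N"
    by (intro slutsky[OF P.prob_space_axioms _ clt]) auto
  with normal show ?thesis by blast
qed

end
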